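(* A pair $(\bar{\mathsf{u}},\bar{\mathsf{z}})\in\mathbb{H}^s(\Omega)\times\mathsf{Z}_{\rm ad}$ is optimal for the fractional optimal control problem if and only if $\bar{\mathsf{u}}=\mathbf{S}\bar{\mathsf{z}}$ and there is $\bar\lambda\in\partial\psi(\bar{\mathsf{z}})$ such that $\bar{\mathsf{z}}$ satisfies the variational inequality $$(\bar{\mathsf{p}}+\sigma\bar{\mathsf{z}}+\nu\bar\lambda,\ \mathsf{z}-\bar{\mathsf{z}})_{L^2(\Omega)}\ge 0\qquad\forall\,\mathsf{z}\in\mathsf{Z}_{\rm ad},$$ where $\bar{\mathsf{p}}=\mathbf{S}^\dagger(\mathbf{S}\bar{\mathsf{z}}-\mathsf{u}_{\rm d})$.
   Context: Let $n\ge 1$, let $\Omega\subset\mathbb{R}^n$ be a bounded, open, convex polytopal domain, and let $s\in(0,1)$. Let $\mathcal{L}w=-\mathrm{div}(A\nabla w)+c\,w$ with homogeneous Dirichlet boundary conditions, where $0\le c\in L^\infty(\Omega)$ and $A\in C^{0,1}(\Omega,\mathrm{GL}(n,\mathbb{R}))$ is symmetric and (uniformly) positive definite. Let $\{(\lambda_k,\varphi_k)\}_{k\in\mathbb{N}}\subset\mathbb{R}_+\times H_0^1(\Omega)$ be the eigenpairs of $\mathcal{L}$ ($\mathcal{L}\varphi_k=\lambda_k\varphi_k$ in $\Omega$, $\varphi_k=0$ on $\partial\Omega$), with $\{\varphi_k\}$ an orthonormal basis of $L^2(\Omega)$. For $w=\sum_k w_k\varphi_k$ with $w_k=\int_\Omega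 w\varphi_k\,dx'$, set $\mathcal{L}^s w=\sum_k\lambda_k^s w_k\varphi_k$ and $\mathbb{H}^s(\Omega)=\{w\in L^2(\Omega):\|w\|_{\mathbb{H}^s(\Omega)}^2:=\sum_k\lambda_k^s|w_k|^2<\infty\}$; $\mathcal{L}^s$ is an isomorphism from $\mathbb{H}^s(\Omega)$ onto its dual. The control to state map $\mathbf{S}$ sends $\mathsf{z}\in L^2(\Omega)$ to the unique solution $\mathsf{u}\in\mathbb{H}^s(\Omega)$ of $\mathcal{L}^s\mathsf{u}=\mathsf{z}$; $\mathbf{S}$ is also regarded as a bounded operator from $L^2(\Omega)$ to itself, and $\mathbf{S}^\dagger$ denotes its $L^2(\Omega)$-adjoint. Let $\sigma,\nu>0$, let $\mathsf{u}_{\rm d}\in L^2(\Omega)$, and let $\mathsf{a},\mathsf{b}\in\mathbb{R}$ with $\mathsf{a}<0<\mathsf{b}$. Set $$J(\mathsf{u},\mathsf{z})=\tfrac12\|\mathsf{u}-\mathsf{u}_{\rm d}\|_{L^2(\Omega)}^2+\tfrac{\sigma}{2}\|\mathsf{z}\|_{L^2(\Omega)}^2+\nu\|\mathsf{z}\|_{L^1(\Omega)},$$ $\mathsf{Z}_{\rm ad}=\{\mathsf{z}\in L^2(\Omega):\mathsf{a}\le\mathsf{z}(x')\le\mathsf{b}\text{ for a.e. }x'\in\Omega\}$. A pair $(\bar{\mathsf{u}},\bar{\mathsf{z}})\in\mathbb{H}^s(\Omega)\times\mathsf{Z}_{\rm ad}$ is called optimal for the fractional optimal control problem if $\bar{\mathsf{u}}=\mathbf{S}\bar{\mathsf{z}}$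 and $J(\bar{\mathsf{u}},\bar{\mathsf{z}})\le J(\mathsf{u},\mathsf{z})$ for all $(\mathsf{u},\mathsf{z})\in\mathbb{H}^s(\Omega)\times\mathsf{Z}_{\rm ad}$ with $\mathsf{u}=\mathbf{S}\mathsf{z}$. $\psi:L^1(\Omega)\to\mathbb{R}$, $\psi(\mathsf{z})=\|\mathsf{z}\|_{L^1(\Omega)}$, and $\partial\psi$ is its convex subdifferential: $\lambda\in\partial\psi(\mathsf{z})$ iff, for a.e. $x'\in\Omega$, $\lambda(x')=1$ where $\mathsf{z}(x')>0$, $\lambda(x')=-1$ where $\mathsf{z}(x')<0$, and $\lambda(x')\in[-1,1]$ where $\mathsf{z}(x')=0$ ($\lambda$ measurable). *)

theory Defs
  imports "HOL-Analysis.Analysis"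
begin

section \<open>Lebesgue spaces on a domain\<close>

text \<open>Elements of \<open>L\<^sup>p(\<Omega>)\<close> are represented by functions on the whole space of which only the
  values on \<open>\<Omega>\<close> matter, up to null sets. Accordingly, equality in \<open>L\<^sup>p(\<Omega>)\<close> is always written as
  equality almost everywhere.\<close>

definition L1 :: "(real^'n) set \<Rightarrow> (real^'n \<Rightarrow> real) set" where
  "L1 \<Omega> = {f. integrable (lebesgue_on \<Omega>) f}"

definition L2 :: "(real^'n) set \<Rightarrow> (real^'n \<Rightarrow> real) set" where
  "L2 \<Omega> = {f \<in> borel_measurable (lebesgue_on \<Omega>). integrable (lebesgue_on \<Omega>) (\<lambda>x. (f x)\<^sup>2)}"

definition Linf :: "(real^'n) set \<Rightarrow> (real^'n \<Rightarrow> real) set" where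
  "Linf \<Omega> = {f \<in> borel_measurable (lebesgue_on \<Omega>). \<exists>M. AE x in lebesgue_on \<Omega>. \<bar>f x\<bar> \<le> M}"

definition L1_norm :: "(real^'n) set \<Rightarrow> (real^'n \<Rightarrow> real) \<Rightarrow> real" where
  "L1_norm \<Omega> f = (\<integral>x. \<bar>f x\<bar> \<partial>lebesgue_on \<Omega>)"

definition L2_inner :: "(real^'n) set \<Rightarrow> (real^'n \<Rightarrow> real) \<Rightarrow> (real^'n \<Rightarrow> real) \<Rightarrow> real" where
  "L2_inner \<Omega> f g = (\<integral>x. f x * g x \<partial>lebesgue_on \<Omega>)"

definition L2_norm :: "(real^'n) set \<Rightarrow> (real^'n \<Rightarrow> real) \<Rightarrow> real" where
  "L2_norm \<Omega> f = sqrt (L2_inner \<Omega> f f)"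

definition L2_orthonormal_basis :: "(real^'n) set \<Rightarrow> (nat \<Rightarrow> real^'n \<Rightarrow> real) \<Rightarrow> bool" where
  "L2_orthonormal_basis \<Omega> \<phi> \<longleftrightarrow>
     (\<forall>k. \<phi> k \<in> L2 \<Omega>) \<and>
     (\<forall>j k. L2_inner \<Omega> (\<phi> j) (\<phi> k) = (if j = k then 1 else 0)) \<and>
     (\<forall>w \<in> L2 \<Omega>.
        (\<lambda>N. L2_norm \<Omega> (\<lambda>x. w x - (\<Sum>k<N. L2_inner \<Omega> w (\<phi> k) * \<phi> k x))) \<longlonglongrightarrow> 0)"

text \<open>The adjoint of an operator on \<open>L\<^sup>2(\<Omega>)\<close>; for a bounded operator it exists and is unique
  up to null sets.\<close>

definition L2_adjoint ::
    "(real^'n) set \<Rightarrow> ((real^'n \<Rightarrow> real) \<Rightarrow> real^'n \<Rightarrow> real) \<Rightarrow> (real^'n \<Rightarrow> real) \<Rightarrow> real^'n \<Rightarrow> real"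
  where
  "L2_adjoint \<Omega> T w =
     (SOME p. p \<in> L2 \<Omega> \<and> (\<forall>v \<in> L2 \<Omega>. L2_inner \<Omega> p v = L2_inner \<Omega> w (T v)))"


section \<open>The space \<open>H\<^sub>0\<^sup>1(\<Omega>)\<close> and the eigenpairs of the elliptic operator\<close>

definition partial_deriv :: "'n \<Rightarrow> (real^'n \<Rightarrow> real) \<Rightarrow> real^'n \<Rightarrow> real" where
  "partial_deriv i f x = frechet_derivative f (at x) (axis i 1)"

primrec C_k :: "nat \<Rightarrow> (real^'n \<Rightarrow> real) \<Rightarrow> bool" where
  "C_k 0 f \<longleftrightarrow> continuous_on UNIV f"
| "C_k (Suc k) f \<longleftrightarrow> f differentiable_on UNIV \<and> (\<forall>i. C_k k (partial_deriv i f))"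

definition test_functions :: "(real^'n) set \<Rightarrow> (real^'n \<Rightarrow> real) set" where
  "test_functions \<Omega> =
     {\<eta>. (\<forall>k. C_k k \<eta>) \<and> compact (closure {x. \<eta> x \<noteq> 0}) \<and> closure {x. \<eta> x \<noteq> 0} \<subseteq> \<Omega>}"

definition has_weak_gradient ::
    "(real^'n) set \<Rightarrow> (real^'n \<Rightarrow> real) \<Rightarrow> (real^'n \<Rightarrow> real^'n) \<Rightarrow> bool" where
  "has_weak_gradient \<Omega> w G \<longleftrightarrow>
     (\<forall>i. (\<lambda>x. G x $ i) \<in> L2 \<Omega> \<and>
          (\<forall>\<eta> \<in> test_functions \<Omega>.
             L2_inner \<Omega> w (partial_deriv i \<eta>) = - L2_inner \<Omega> (\<lambda>x. G x $ i) \<eta>))"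

text \<open>The closure of the test functions with respect to the norm of \<open>H\<^sup>1(\<Omega>)\<close>.\<close>

definition H10 :: "(real^'n) set \<Rightarrow> (real^'n \<Rightarrow> real) set" where
  "H10 \<Omega> =
     {w \<in> L2 \<Omega>. \<exists>G. has_weak_gradient \<Omega> w G \<and>
        (\<forall>\<epsilon>>0. \<exists>\<eta> \<in> test_functions \<Omega>.
           sqrt ((L2_norm \<Omega> (\<lambda>x. w x - \<eta> x))\<^sup>2 +
                 (\<Sum>i\<in>UNIV. (L2_norm \<Omega> (\<lambda>x. G x $ i - partial_deriv i \<eta> x))\<^sup>2)) < \<epsilon>)}"

definition elliptic_coefficients ::
    "(real^'n) set \<Rightarrow> (real^'n \<Rightarrow> real^'n^'n) \<Rightarrow> (real^'n \<Rightarrow> real) \<Rightarrow> bool" where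
  "elliptic_coefficients \<Omega> A c \<longleftrightarrow>
     (\<exists>L. L-lipschitz_on \<Omega> A) \<and>
     (\<forall>x\<in>\<Omega>. invertible (A x) \<and> transpose (A x) = A x) \<and>
     (\<exists>\<alpha>>0. \<forall>x\<in>\<Omega>. \<forall>\<xi>. \<alpha> * (norm \<xi>)\<^sup>2 \<le> (A x *v \<xi>) \<bullet> \<xi>) \<and>
     c \<in> Linf \<Omega> \<and> (AE x in lebesgue_on \<Omega>. 0 \<le> c x)"

text \<open>\<open>-div (A \<nabla>\<phi>) + c \<phi> = \<mu> \<phi>\<close> in \<open>\<Omega>\<close>, \<open>\<phi> = 0\<close> on \<open>\<partial>\<Omega>\<close>, in the weak sense. Weak gradients are
  unique up to null sets, so the quantification over \<open>G\<close> and \<open>H\<close> only names \<open>\<nabla>\<phi>\<close> and \<open>\<nabla>v\<close>.\<close>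

definition eigenpair ::
    "(real^'n) set \<Rightarrow> (real^'n \<Rightarrow> real^'n^'n) \<Rightarrow> (real^'n \<Rightarrow> real) \<Rightarrow> real \<Rightarrow> (real^'n \<Rightarrow> real) \<Rightarrow> bool"
  where
  "eigenpair \<Omega> A c \<mu> \<phi> \<longleftrightarrow>
     \<phi> \<in> H10 \<Omega> \<and> \<not> (AE x in lebesgue_on \<Omega>. \<phi> x = 0) \<and>
     (\<forall>G. has_weak_gradient \<Omega> \<phi> G \<longrightarrow>
        (\<forall>v \<in> H10 \<Omega>. \<forall>H. has_weak_gradient \<Omega> v H \<longrightarrow>
           (\<integral>x. (A x *v G x) \<bullet> H x + c x * \<phi> x * v x \<partial>lebesgue_on \<Omega>) = \<mu> * L2_inner \<Omega> \<phi> v))"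


section \<open>Spectral fractional powers and the control to state map\<close>

definition Hs ::
    "(real^'n) set \<Rightarrow> (nat \<Rightarrow> real) \<Rightarrow> (nat \<Rightarrow> real^'n \<Rightarrow> real) \<Rightarrow> real \<Rightarrow> (real^'n \<Rightarrow> real) set" where
  "Hs \<Omega> lam \<phi> s =
     {w \<in> L2 \<Omega>. summable (\<lambda>k. lam k powr s * \<bar>L2_inner \<Omega> w (\<phi> k)\<bar>\<^sup>2)}"

text \<open>For \<open>w\<close> in the space \<open>Hs\<close>, the series \<open>\<Sum>\<^sub>k \<lambda>\<^sub>k\<^sup>s w\<^sub>k \<phi>\<^sub>k\<close> converges in the dual of that space,
  not in \<open>L\<^sup>2(\<Omega>)\<close> in general. It is therefore given by its action on \<open>v\<close> in \<open>Hs\<close>; an element \<open>z\<close> of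
  \<open>L\<^sup>2(\<Omega>)\<close> acts on \<open>v\<close> through the inner product.\<close>

definition frac_power ::
    "(real^'n) set \<Rightarrow> (nat \<Rightarrow> real) \<Rightarrow> (nat \<Rightarrow> real^'n \<Rightarrow> real) \<Rightarrow> real \<Rightarrow>
     (real^'n \<Rightarrow> real) \<Rightarrow> (real^'n \<Rightarrow> real) \<Rightarrow> real" where
  "frac_power \<Omega> lam \<phi> s w v =
     (\<Sum>k. lam k powr s * L2_inner \<Omega> w (\<phi> k) * L2_inner \<Omega> (\<phi> k) v)"

definition control_to_state ::
    "(real^'n) set \<Rightarrow> (nat \<Rightarrow> real) \<Rightarrow> (nat \<Rightarrow> real^'n \<Rightarrow> real) \<Rightarrow> real \<Rightarrow>
     (real^'n \<Rightarrow> real) \<Rightarrow> real^'n \<Rightarrow> real" where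
  "control_to_state \<Omega> lam \<phi> s z =
     (SOME u. u \<in> Hs \<Omega> lam \<phi> s \<and>
        (\<forall>v \<in> Hs \<Omega> lam \<phi> s. frac_power \<Omega> lam \<phi> s u v = L2_inner \<Omega> z v))"


section \<open>The fractional optimal control problem\<close>

definition cost ::
    "(real^'n) set \<Rightarrow> real \<Rightarrow> real \<Rightarrow> (real^'n \<Rightarrow> real) \<Rightarrow> (real^'n \<Rightarrow> real) \<Rightarrow> (real^'n \<Rightarrow> real) \<Rightarrow> real"
  where
  "cost \<Omega> \<sigma> \<nu> ud u z =
     1/2 * (L2_norm \<Omega> (\<lambda>x. u x - ud x))\<^sup>2 + \<sigma>/2 * (L2_norm \<Omega> z)\<^sup>2 + \<nu> * L1_norm \<Omega> z"

definition Zad :: "(real^'n) set \<Rightarrow> real \<Rightarrow> real \<Rightarrow> (real^'n \<Rightarrow> real) set" where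
  "Zad \<Omega> a b = {z \<in> L2 \<Omega>. AE x in lebesgue_on \<Omega>. a \<le> z x \<and> z x \<le> b}"

definition optimal_pair ::
    "(real^'n) set \<Rightarrow> (nat \<Rightarrow> real) \<Rightarrow> (nat \<Rightarrow> real^'n \<Rightarrow> real) \<Rightarrow> real \<Rightarrow> real \<Rightarrow> real \<Rightarrow>
     (real^'n \<Rightarrow> real) \<Rightarrow> real \<Rightarrow> real \<Rightarrow> (real^'n \<Rightarrow> real) \<Rightarrow> (real^'n \<Rightarrow> real) \<Rightarrow> bool" where
  "optimal_pair \<Omega> lam \<phi> s \<sigma> \<nu> ud a b u z \<longleftrightarrow>
     u \<in> Hs \<Omega> lam \<phi> s \<and> z \<in> Zad \<Omega> a b \<and>
     (AE x in lebesgue_on \<Omega>. u x = control_to_state \<Omega> lam \<phi> s z x) \<and>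
     (\<forall>u' \<in> Hs \<Omega> lam \<phi> s. \<forall>z' \<in> Zad \<Omega> a b.
        (AE x in lebesgue_on \<Omega>. u' x = control_to_state \<Omega> lam \<phi> s z' x) \<longrightarrow>
        cost \<Omega> \<sigma> \<nu> ud u z \<le> cost \<Omega> \<sigma> \<nu> ud u' z')"

text \<open>The convex subdifferential of a functional on \<open>L\<^sup>1(\<Omega>)\<close>, whose dual is \<open>L\<^sup>\<infinity>(\<Omega>)\<close>.\<close>

definition L1_subdifferential ::
    "(real^'n) set \<Rightarrow> ((real^'n \<Rightarrow> real) \<Rightarrow> real) \<Rightarrow> (real^'n \<Rightarrow> real) \<Rightarrow> (real^'n \<Rightarrow> real) set" where
  "L1_subdifferential \<Omega> \<psi> z =
     {l \<in> Linf \<Omega>. \<forall>y \<in> L1 \<Omega>. \<psi> z + (\<integral>x. l x * (y x - z x) \<partial>lebesgue_on \<Omega>) \<le> \<psi> y}"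

lemma L1_norm_subgradient_pointwise:
  fixes z l y :: "real^'n \<Rightarrow> real"
  assumes l: "l \<in> L1_subdifferential \<Omega> (L1_norm \<Omega>) z" and z: "z \<in> L1 \<Omega>" and y: "y \<in> L1 \<Omega>"
  shows "AE x in lebesgue_on \<Omega>. \<bar>z x\<bar> + l x * (y x - z x) \<le> \<bar>y x\<bar>"
proof -
  define M where "M = lebesgue_on \<Omega>"
  have zi [simp]: "integrable M z" and yi [simp]: "integrable M y"
    using z y by (auto simp: L1_def M_def)
  have lm [measurable]: "l \<in> borel_measurable M"
    using l by (auto simp: L1_subdifferential_def Linf_def M_def)
  obtain B where B: "AE x in M. \<bar>l x\<bar> \<le> B"
    using l unfolding L1_subdifferential_def Linf_def M_def by blast
  have [measurable]: "z \<in> borel_measurable M" "y \<in> borel_measurable M"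
    by (auto intro: borel_measurable_integrable)
  have li: "integrable M (\<lambda>x. l x * w x)" if w: "integrable M w" for w
  proof (rule Bochner_Integration.integrable_bound)
    show "integrable M (\<lambda>x. B * w x)" using w by simp
    show "(\<lambda>x. l x * w x) \<in> borel_measurable M"
      using borel_measurable_integrable[OF w] by measurable
    show "AE x in M. norm (l x * w x) \<le> norm (B * w x)"
      using B by eventually_elim (auto simp: abs_mult intro!: mult_right_mono)
  qed
  define g where "g x = \<bar>y x\<bar> - \<bar>z x\<bar> - l x * (y x - z x)" for x
  define h where "h x = (if g x < 0 then y x else z x)" for x
  have [measurable]: "g \<in> borel_measurable M" unfolding g_def by measurable
  have [simp]: "integrable M g" unfolding g_def by (intro Bochner_Integration.integrable_diff li) auto
  have hi [simp]: "integrable M h"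
  proof (rule Bochner_Integration.integrable_bound)
    show "integrable M (\<lambda>x. \<bar>y x\<bar> + \<bar>z x\<bar>)" by simp
    show "h \<in> borel_measurable M" unfolding h_def by measurable
  qed (auto simp: h_def)
  have "L1_norm \<Omega> z + (\<integral>x. l x * (h x - z x) \<partial>M) \<le> L1_norm \<Omega> h"
    using l hi by (auto simp: L1_subdifferential_def L1_def M_def)
  moreover have "integrable M (\<lambda>x. l x * (h x - z x))" by (intro li) simp
  ultimately have "0 \<le> (\<integral>x. \<bar>h x\<bar> - \<bar>z x\<bar> - l x * (h x - z x) \<partial>M)"
    by (simp add: L1_norm_def flip: M_def)
  also have "(\<lambda>x. \<bar>h x\<bar> - \<bar>z x\<bar> - l x * (h x - z x)) = (\<lambda>x. min (g x) 0)"
    by (auto simp: h_def g_def min_def fun_eq_iff)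
  finally have "(\<integral>x. - min (g x) 0 \<partial>M) \<le> 0" by simp
  moreover have mi: "integrable M (\<lambda>x. - min (g x) 0)" by simp
  ultimately have "(\<integral>x. - min (g x) 0 \<partial>M) = 0"
    by (intro antisym integral_nonneg_AE) auto
  then have "AE x in M. - min (g x) 0 = 0"
    using integral_nonneg_eq_0_iff_AE[OF mi] by auto
  then show ?thesis unfolding M_def g_def by eventually_elim (auto simp: min_def split: if_splits)
qed

lemma L1_norm_subdifferential_iff:
  fixes z l :: "real^'n \<Rightarrow> real"
  assumes \<Omega>: "\<Omega> \<in> lmeasurable" and z: "z \<in> L1 \<Omega>"
  shows "l \<in> L1_subdifferential \<Omega> (L1_norm \<Omega>) z \<longleftrightarrow>
    l \<in> borel_measurable (lebesgue_on \<Omega>) \<and>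
    (AE x in lebesgue_on \<Omega>. (z x > 0 \<longrightarrow> l x = 1) \<and> (z x < 0 \<longrightarrow> l x = - 1) \<and>
                          (z x = 0 \<longrightarrow> l x \<in> {- 1..1}))"
    (is "?L \<longleftrightarrow> ?m \<and> (AE x in _. ?P x)")
proof
  have zi: "integrable (lebesgue_on \<Omega>) z" using z by (simp add: L1_def)
  have ci: "integrable (lebesgue_on \<Omega>) (\<lambda>x. c)" for c :: real
    using \<Omega> by (auto intro!: finite_measure.integrable_const finite_measure_lebesgue_on)
  {
    assume ?L
    have m: ?m using \<open>?L\<close> by (auto simp: L1_subdifferential_def Linf_def)
    have mem: "(\<lambda>x. 0) \<in> L1 \<Omega>" "(\<lambda>x. 2 * z x) \<in> L1 \<Omega>"
        "(\<lambda>x. z x + 1) \<in> L1 \<Omega>" "(\<lambda>x. z x - 1) \<in> L1 \<Omega>"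
      using zi ci[of 1] by (auto simp: L1_def)
    have "AE x in lebesgue_on \<Omega>. ?P x"
      using L1_norm_subgradient_pointwise[OF \<open>?L\<close> z mem(1)]
        L1_norm_subgradient_pointwise[OF \<open>?L\<close> z mem(2)]
        L1_norm_subgradient_pointwise[OF \<open>?L\<close> z mem(3)]
        L1_norm_subgradient_pointwise[OF \<open>?L\<close> z mem(4)]
    proof eventually_elim
      case (elim x)
      have a: "\<bar>z x\<bar> \<le> l x * z x" using elim(1) by simp
      have b: "l x * z x \<le> \<bar>z x\<bar>" using elim(2) by (simp add: abs_mult)
      have e: "l x * z x = \<bar>z x\<bar>" using a b by simp
      have "l x = 1" if "z x > 0" using e that by simp
      moreover have "l x = - 1" if "z x < 0"
      proof -
        have "(l x + 1) * z x = 0" using e that by (simp add: distrib_right)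
        then show ?thesis using that by simp
      qed
      ultimately show ?case using elim(3,4) by auto
    qed
    then show "?m \<and> (AE x in lebesgue_on \<Omega>. ?P x)" using m by blast
  }
  {
    assume R: "?m \<and> (AE x in lebesgue_on \<Omega>. ?P x)"
    then have lm [measurable]: "l \<in> borel_measurable (lebesgue_on \<Omega>)" by blast
    have lb: "AE x in lebesgue_on \<Omega>. \<bar>l x\<bar> \<le> 1"
      using conjunct2[OF R]
    proof eventually_elim
      case (elim x)
      then show ?case by (cases "z x" "0::real" rule: linorder_cases) auto
    qed
    have "L1_norm \<Omega> z + (\<integral>x. l x * (y x - z x) \<partial>lebesgue_on \<Omega>) \<le> L1_norm \<Omega> y"
      if y: "y \<in> L1 \<Omega>" for y
    proof -
      have yi: "integrable (lebesgue_on \<Omega>) y" using y by (simp add: L1_def)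
      have [measurable]: "y \<in> borel_measurable (lebesgue_on \<Omega>)" "z \<in> borel_measurable (lebesgue_on \<Omega>)"
        using yi zi by (auto intro: borel_measurable_integrable)
      have i: "integrable (lebesgue_on \<Omega>) (\<lambda>x. l x * (y x - z x))"
      proof (rule Bochner_Integration.integrable_bound)
        show "integrable (lebesgue_on \<Omega>) (\<lambda>x. y x - z x)" using yi zi by simp
        show "AE x in lebesgue_on \<Omega>. norm (l x * (y x - z x)) \<le> norm (y x - z x)"
          using lb by eventually_elim (simp add: abs_mult mult_left_le_one_le)
      qed measurable
      have "L1_norm \<Omega> z + (\<integral>x. l x * (y x - z x) \<partial>lebesgue_on \<Omega>) =
          (\<integral>x. \<bar>z x\<bar> + l x * (y x - z x) \<partial>lebesgue_on \<Omega>)"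
        using zi i by (simp add: L1_norm_def)
      also have "\<dots> \<le> (\<integral>x. \<bar>y x\<bar> \<partial>lebesgue_on \<Omega>)"
      proof (rule integral_mono_AE)
        show "AE x in lebesgue_on \<Omega>. \<bar>z x\<bar> + l x * (y x - z x) \<le> \<bar>y x\<bar>"
          using conjunct2[OF R] lb
        proof eventually_elim
          case (elim x)
          have "l x * z x = \<bar>z x\<bar>"
            using elim(1) by (cases "z x" "0::real" rule: linorder_cases) auto
          moreover have "l x * y x \<le> \<bar>y x\<bar>"
            using elim(2) by (metis abs_ge_self abs_ge_zero abs_mult mult_left_le_one_le order_trans)
          ultimately show ?case by (simp add: right_diff_distrib)
        qed
      qed (use zi i yi in auto)
      finally show ?thesis by (simp add: L1_norm_def)
    qed
    then show ?L using lb by (auto simp: L1_subdifferential_def Linf_def)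
  }
qed

end

theory Submission
  imports Defs
begin

text \<open>The reduced cost \<open>f z = cost (S z) z\<close> is the sum of a quadratic functional and of \<open>\<nu>\<close> times the
  norm of \<open>L\<^sup>1(\<Omega>)\<close>, and both directions are read off its exact expansion along segments. For
  necessity, dividing by the step size gives \<open>(q, z - zbar) + \<nu> (\<parallel>z\<parallel>\<^sub>1 - \<parallel>zbar\<parallel>\<^sub>1) \<ge> 0\<close> with
  \<open>q = pbar + \<sigma> zbar\<close>. This inequality localizes to points of \<open>\<Omega>\<close>, where it determines a subgradient.
  The operator \<open>S\<close> is given by \<open>(S z)\<^sub>k = (\<lambda>\<^sub>k powr (- s)) z\<^sub>k\<close>. By the Riesz-Fischer theorem it is well defined
  as soon as the eigenvalues are bounded away from zero, which is a Poincare inequality.\<close>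

section \<open>The Hilbert space \<open>L\<^sup>2(\<Omega>)\<close>\<close>

text \<open>The hypotheses make each \<open>lam k\<close> positive but state no common lower bound,
  and without one the multiplier \<open>lam k powr - s\<close> could be unbounded. Since
  \<open>control_to_state\<close> and \<open>L2_adjoint\<close> are choices by \<open>SOME\<close>,
  nothing is known about them until a witness is constructed, and even then the control to state map
  respects linear combinations only up to null sets. Hence functions are compared through their
  coefficients in the basis, and the cost has to be shown to be blind to null sets. The other
  obstacle is that the norm of \<open>L1 \<Omega>\<close> is not differentiable. Its convexity along
  a segment takes the place of a derivative, and the multiplier has freedom only where
  \<open>zbar\<close> vanishes; there it is chosen so that \<open>q x + \<nu> * l x\<close> is
  zero.\<close>

lemma L2_measurable: "f \<in> L2 \<Omega> \<Longrightarrow> f \<in> borel_measurable (lebesgue_on \<Omega>)"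
  by (simp add: L2_def)

lemma L2_integrable_power2: "f \<in> L2 \<Omega> \<Longrightarrow> integrable (lebesgue_on \<Omega>) (\<lambda>x. (f x)\<^sup>2)"
  by (simp add: L2_def)

lemma L2_integrable_mult:
  assumes "f \<in> L2 \<Omega>" "g \<in> L2 \<Omega>"
  shows "integrable (lebesgue_on \<Omega>) (\<lambda>x. f x * g x)"
proof (rule Bochner_Integration.integrable_bound)
  show "integrable (lebesgue_on \<Omega>) (\<lambda>x. (f x)\<^sup>2 + (g x)\<^sup>2)"
    using assms by (simp add: L2_integrable_power2)
  show "(\<lambda>x. f x * g x) \<in> borel_measurable (lebesgue_on \<Omega>)"
    using assms[THEN L2_measurable] by measurable
  have "\<bar>u * v\<bar> \<le> u\<^sup>2 + v\<^sup>2" for u v :: real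
    using sum_squares_bound[of u v] sum_squares_bound[of u "- v"] sum_power2_ge_zero[of u v]
    unfolding abs_le_iff by simp
  then show "AE x in lebesgue_on \<Omega>. norm (f x * g x) \<le> norm ((f x)\<^sup>2 + (g x)\<^sup>2)"
    by simp
qed

lemma L2_scale:
  assumes "f \<in> L2 \<Omega>" shows "(\<lambda>x. c * f x) \<in> L2 \<Omega>"
  using assms by (auto simp: L2_def power_mult_distrib)

lemma L2_add:
  assumes "f \<in> L2 \<Omega>" "g \<in> L2 \<Omega>" shows "(\<lambda>x. f x + g x) \<in> L2 \<Omega>"
proof -
  have "integrable (lebesgue_on \<Omega>) (\<lambda>x. (f x)\<^sup>2 + (g x)\<^sup>2 + 2 * (f x * g x))"
    using assms by (auto intro!: Bochner_Integration.integrable_add L2_integrable_power2 integrable_mult_right L2_integrable_mult)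
  then show ?thesis using assms by (auto simp: L2_def power2_sum mult.assoc)
qed

lemma L2_diff:
  assumes "f \<in> L2 \<Omega>" "g \<in> L2 \<Omega>" shows "(\<lambda>x. f x - g x) \<in> L2 \<Omega>"
  using L2_add[OF assms(1) L2_scale[OF assms(2), of "-1"]] by simp

lemma L2_zero: "(\<lambda>x. 0) \<in> L2 \<Omega>"
  by (simp add: L2_def)

lemma L2_sum:
  assumes "\<And>i. i \<in> I \<Longrightarrow> f i \<in> L2 \<Omega>" shows "(\<lambda>x. \<Sum>i\<in>I. f i x) \<in> L2 \<Omega>"
  using assms by (induction I rule: infinite_finite_induct) (simp_all add: L2_zero L2_add)

lemma L2_const:
  assumes "\<Omega> \<in> lmeasurable" shows "(\<lambda>x. c) \<in> L2 \<Omega>"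
  using assms by (auto simp: L2_def intro!: finite_measure.integrable_const finite_measure_lebesgue_on)

text \<open>The multiplier \<open>m\<close> will be a coordinate on the bounded domain, or a bounded
  function that multiplies the constant 1.\<close>

lemma L2_bounded_mult:
  assumes m: "m \<in> borel_measurable (lebesgue_on \<Omega>)" and B: "AE x in lebesgue_on \<Omega>. \<bar>m x\<bar> \<le> B"
    and f: "f \<in> L2 \<Omega>"
  shows "(\<lambda>x. m x * f x) \<in> L2 \<Omega>"
proof -
  have [measurable]: "m \<in> borel_measurable (lebesgue_on \<Omega>)" "f \<in> borel_measurable (lebesgue_on \<Omega>)"
    using m L2_measurable[OF f] by auto
  have "integrable (lebesgue_on \<Omega>) (\<lambda>x. (m x * f x)\<^sup>2)"
  proof (rule Bochner_Integration.integrable_bound)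
    show "integrable (lebesgue_on \<Omega>) (\<lambda>x. (B * f x)\<^sup>2)"
      using L2_integrable_power2[OF L2_scale[OF f]] .
    show "AE x in lebesgue_on \<Omega>. norm ((m x * f x)\<^sup>2) \<le> norm ((B * f x)\<^sup>2)"
      using B
    proof eventually_elim
      case (elim x)
      then have "\<bar>m x * f x\<bar> \<le> \<bar>B * f x\<bar>" by (simp add: abs_mult mult_right_mono)
      then show ?case by (simp add: abs_le_square_iff)
    qed
  qed measurable
  then show ?thesis by (simp add: L2_def)
qed

section \<open>Algebra of the inner product, Cauchy-Schwarz inequality and limits\<close>

lemma L2_inner_commute: "L2_inner \<Omega> f g = L2_inner \<Omega> g f"
  by (simp add: L2_inner_def mult.commute)

lemma L2_inner_add_left:
  assumes "f \<in> L2 \<Omega>" "g \<in> L2 \<Omega>" "h \<in> L2 \<Omega>"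
  shows "L2_inner \<Omega> (\<lambda>x. f x + g x) h = L2_inner \<Omega> f h + L2_inner \<Omega> g h"
  using assms by (simp add: L2_inner_def distrib_right L2_integrable_mult)

lemma L2_inner_diff_left:
  assumes "f \<in> L2 \<Omega>" "g \<in> L2 \<Omega>" "h \<in> L2 \<Omega>"
  shows "L2_inner \<Omega> (\<lambda>x. f x - g x) h = L2_inner \<Omega> f h - L2_inner \<Omega> g h"
  using assms by (simp add: L2_inner_def left_diff_distrib L2_integrable_mult)

lemma L2_inner_add_right:
  assumes "f \<in> L2 \<Omega>" "g \<in> L2 \<Omega>" "h \<in> L2 \<Omega>"
  shows "L2_inner \<Omega> h (\<lambda>x. f x + g x) = L2_inner \<Omega> h f + L2_inner \<Omega> h g"
  using L2_inner_add_left[OF assms] by (simp add: L2_inner_commute)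

lemma L2_inner_scale_left: "L2_inner \<Omega> (\<lambda>x. c * f x) h = c * L2_inner \<Omega> f h"
  by (simp add: L2_inner_def mult.assoc)

lemma L2_inner_scale_right: "L2_inner \<Omega> h (\<lambda>x. c * f x) = c * L2_inner \<Omega> h f"
  using L2_inner_scale_left by (metis L2_inner_commute)

lemma L2_inner_sum_left:
  assumes "\<And>i. i \<in> I \<Longrightarrow> f i \<in> L2 \<Omega>" "h \<in> L2 \<Omega>"
  shows "L2_inner \<Omega> (\<lambda>x. \<Sum>i\<in>I. f i x) h = (\<Sum>i\<in>I. L2_inner \<Omega> (f i) h)"
  using assms by (simp add: L2_inner_def sum_distrib_right L2_integrable_mult)

lemma L2_inner_cong_AE:
  assumes "f \<in> L2 \<Omega>" "f' \<in> L2 \<Omega>" "g \<in> L2 \<Omega>" "g' \<in> L2 \<Omega>"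
    and "AE x in lebesgue_on \<Omega>. f x = f' x" "AE x in lebesgue_on \<Omega>. g x = g' x"
  shows "L2_inner \<Omega> f g = L2_inner \<Omega> f' g'"
  unfolding L2_inner_def
proof (rule integral_cong_AE)
  show "AE x in lebesgue_on \<Omega>. f x * g x = f' x * g' x"
    using assms(5,6) by eventually_elim simp
qed (use assms(1-4)[THEN L2_measurable] in measurable)

lemma L2_inner_self_nonneg: "0 \<le> L2_inner \<Omega> f f"
  by (simp add: L2_inner_def)

lemma L2_norm_power2: "(L2_norm \<Omega> f)\<^sup>2 = L2_inner \<Omega> f f"
  by (simp add: L2_norm_def L2_inner_self_nonneg)

lemma L2_norm_nonneg: "0 \<le> L2_norm \<Omega> f"
  by (simp add: L2_norm_def L2_inner_self_nonneg)

lemma L2_inner_self_eq_0_iff: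
  assumes "f \<in> L2 \<Omega>"
  shows "L2_inner \<Omega> f f = 0 \<longleftrightarrow> (AE x in lebesgue_on \<Omega>. f x = 0)"
  using integral_nonneg_eq_0_iff_AE[OF L2_integrable_mult[OF assms assms]]
  by (simp add: L2_inner_def)

text \<open>This polynomial in \<open>t\<close> serves twice: its nonnegativity gives the
  Cauchy-Schwarz inequality, and both quadratic terms of the cost are expanded by it.\<close>

lemma L2_inner_self_add_scale:
  assumes f: "f \<in> L2 \<Omega>" and g: "g \<in> L2 \<Omega>"
  shows "L2_inner \<Omega> (\<lambda>x. f x + t * g x) (\<lambda>x. f x + t * g x) =
    L2_inner \<Omega> f f + 2 * t * L2_inner \<Omega> f g + t\<^sup>2 * L2_inner \<Omega> g g"
proof -
  have tg: "(\<lambda>x. t * g x) \<in> L2 \<Omega>" and s: "(\<lambda>x. f x + t * g x) \<in> L2 \<Omega>"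
    using f g by (auto intro: L2_add L2_scale)
  show ?thesis
    by (simp add: L2_inner_add_left[OF f tg s] L2_inner_add_right[OF f tg f]
        L2_inner_add_right[OF f tg g] L2_inner_scale_left L2_inner_scale_right
        L2_inner_commute[of \<Omega> g f] power2_eq_square algebra_simps)
qed

lemma L2_Cauchy_Schwarz:
  assumes f: "f \<in> L2 \<Omega>" and g: "g \<in> L2 \<Omega>"
  shows "\<bar>L2_inner \<Omega> f g\<bar> \<le> L2_norm \<Omega> f * L2_norm \<Omega> g"
proof -
  have q: "0 \<le> L2_inner \<Omega> f f + 2 * t * L2_inner \<Omega> f g + t\<^sup>2 * L2_inner \<Omega> g g" for t
    using L2_inner_self_add_scale[OF f g, of t] L2_inner_self_nonneg[of \<Omega> "\<lambda>x. f x + t * g x"]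
    by simp
  have "(L2_inner \<Omega> f g)\<^sup>2 \<le> L2_inner \<Omega> f f * L2_inner \<Omega> g g"
  proof (cases "L2_inner \<Omega> g g = 0")
    case True
    then have "AE x in lebesgue_on \<Omega>. g x = 0" using L2_inner_self_eq_0_iff[OF g] by simp
    then have "L2_inner \<Omega> f g = L2_inner \<Omega> f (\<lambda>x. 0)"
      using f g by (intro L2_inner_cong_AE) (auto intro: L2_zero)
    then show ?thesis using True by (simp add: L2_inner_def)
  next
    case False
    then have "0 < L2_inner \<Omega> g g" using L2_inner_self_nonneg[of \<Omega> g] by simp
    \<comment> \<open>This value of \<open>t\<close> minimizes the quadratic polynomial in
      \<open>q\<close>.\<close>
    then show ?thesis using q[of "- L2_inner \<Omega> f g / L2_inner \<Omega> g g"]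
      by (simp add: field_simps power2_eq_square)
  qed
  from real_sqrt_le_mono[OF this]
  have "\<bar>L2_inner \<Omega> f g\<bar> \<le> sqrt (L2_inner \<Omega> f f * L2_inner \<Omega> g g)"
    by (simp only: real_sqrt_abs)
  then show ?thesis by (simp add: L2_norm_def real_sqrt_mult)
qed

text \<open>By Cauchy-Schwarz the error is at most the norm of the difference times the norm of
  \<open>v\<close>. Norm convergence enters later in this form, for basis coefficients and for weak
  gradients.\<close>

lemma L2_inner_tendsto_left:
  assumes "\<And>n. f n \<in> L2 \<Omega>" "u \<in> L2 \<Omega>" "v \<in> L2 \<Omega>"
    and "(\<lambda>n. L2_norm \<Omega> (\<lambda>x. u x - f n x)) \<longlonglongrightarrow> 0"
  shows "(\<lambda>n. L2_inner \<Omega> (f n) v) \<longlonglongrightarrow> L2_inner \<Omega> u v"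
proof -
  have "(\<lambda>n. L2_inner \<Omega> u v - L2_inner \<Omega> (f n) v) \<longlonglongrightarrow> 0"
  proof (rule Lim_null_comparison)
    show "\<forall>\<^sub>F n in sequentially. norm (L2_inner \<Omega> u v - L2_inner \<Omega> (f n) v)
        \<le> L2_norm \<Omega> (\<lambda>x. u x - f n x) * L2_norm \<Omega> v"
      using L2_Cauchy_Schwarz[OF L2_diff[OF assms(2,1)] assms(3)]
      by (simp add: L2_inner_diff_left assms)
    show "(\<lambda>n. L2_norm \<Omega> (\<lambda>x. u x - f n x) * L2_norm \<Omega> v) \<longlonglongrightarrow> 0"
      using tendsto_mult_right[OF assms(4)] by (auto intro!: tendsto_eq_intros assms(4))
  qed
  then show ?thesis
    using tendsto_diff[OF tendsto_const[of "L2_inner \<Omega> u v"]] by fastforce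
qed

text \<open>The sum of \<open>4\<^sup>n (d n)\<^sup>2\<close> is an integrable function \<open>E\<close> with \<open>\<bar>d n\<bar> \<le> sqrt E / 2\<^sup>n\<close> almost
  everywhere, so the tails of the series are dominated without an appeal to Fatou's lemma.\<close>

lemma L2_complete_series:
  assumes d: "\<And>n. d n \<in> L2 \<Omega>" and small: "\<And>n. L2_inner \<Omega> (d n) (d n) \<le> (1/8)^n"
  obtains u where "u \<in> L2 \<Omega>" "(\<lambda>m. L2_norm \<Omega> (\<lambda>x. u x - (\<Sum>n<m. d n x))) \<longlonglongrightarrow> 0"
proof -
  define M where "M = lebesgue_on \<Omega>"
  have [measurable]: "\<And>n. d n \<in> borel_measurable M" using d by (simp add: M_def L2_measurable)
  have pow4: "(y^n)\<^sup>2 = (y\<^sup>2)^n" for y :: real and n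
    by (simp add: mult.commute flip: power_mult)
  define F where "F x = (\<Sum>n. ennreal (4^n * (d n x)\<^sup>2))" for x
  have [measurable]: "F \<in> borel_measurable M" unfolding F_def by measurable
  \<comment> \<open>The rate 1/8 of the hypothesis absorbs the weight \<open>4^n\<close> and still
    leaves a convergent geometric series.\<close>
  have i1: "(\<integral>\<^sup>+x. ennreal (4^n * (d n x)\<^sup>2) \<partial>M) \<le> ennreal ((1/2)^n)" for n
  proof -
    have "integrable M (\<lambda>x. 4^n * (d n x)\<^sup>2)"
      using d L2_integrable_power2 by (auto simp: M_def)
    then have "(\<integral>\<^sup>+x. ennreal (4^n * (d n x)\<^sup>2) \<partial>M) = ennreal (4^n * L2_inner \<Omega> (d n) (d n))"
      by (subst nn_integral_eq_integral) (auto simp: L2_inner_def M_def power2_eq_square)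
    also have "\<dots> \<le> ennreal (4^n * (1/8)^n)" using small by (intro ennreal_leI mult_left_mono) auto
    also have "4^n * (1/8)^n = (1/2::real)^n" by (simp flip: power_mult_distrib)
    finally show ?thesis .
  qed
  have "(\<integral>\<^sup>+x. F x \<partial>M) = (\<Sum>n. \<integral>\<^sup>+x. ennreal (4^n * (d n x)\<^sup>2) \<partial>M)"
    unfolding F_def by (rule nn_integral_suminf) measurable
  also have "\<dots> \<le> (\<Sum>n. ennreal ((1/2)^n))" by (intro suminf_le i1) auto
  also have "\<dots> = ennreal (\<Sum>n. (1/2)^n)" by (intro suminf_ennreal2) (auto simp: summable_geometric)
  finally have Ffin: "(\<integral>\<^sup>+x. F x \<partial>M) < top" by (rule le_less_trans[OF _ ennreal_less_top])
  then have AEF: "AE x in M. F x \<noteq> \<infinity>" by (intro nn_integral_PInf_AE) (simp_all add: infinity_ennreal_def)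
  \<comment> \<open>\<open>enn2real\<close> sends infinite values to 0, which alters
    \<open>F\<close> only on a null set and makes \<open>E\<close> real-valued everywhere.\<close>
  define E where "E x = enn2real (F x)" for x
  have [measurable]: "E \<in> borel_measurable M" unfolding E_def by measurable
  have E0: "0 \<le> E x" for x by (simp add: E_def)
  have "(\<integral>\<^sup>+x. ennreal (E x) \<partial>M) = (\<integral>\<^sup>+x. F x \<partial>M)"
  proof (rule nn_integral_cong_AE)
    show "AE x in M. ennreal (E x) = F x"
      using AEF by eventually_elim (simp add: E_def ennreal_enn2real_if)
  qed
  then have EI: "integrable M E"
    using Ffin E0 by (intro integrableI_nonneg) (simp_all add: infinity_ennreal_def)
  have bound: "AE x in M. \<forall>n. \<bar>d n x\<bar> \<le> sqrt (E x) * (1/2)^n"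
    using AEF
  proof eventually_elim
    case (elim x)
    show ?case
    proof
      fix n
      have "(\<Sum>i\<in>{n}. ennreal (4^i * (d i x)\<^sup>2)) \<le> F x"
        unfolding F_def by (intro sum_le_suminf summableI) auto
      then have "ennreal (4^n * (d n x)\<^sup>2) \<le> F x"
        by (simp only: sum.insert finite.emptyI empty_iff not_False_eq_True sum.empty add_0_right)
      also have "\<dots> = ennreal (E x)" using elim by (simp add: E_def ennreal_enn2real_if)
      finally have "4^n * (d n x)\<^sup>2 \<le> E x" using E0[of x] by (simp only: ennreal_le_iff)
      moreover have "(2^n * d n x)\<^sup>2 = 4^n * (d n x)\<^sup>2"
        using pow4[of 2 n] by (simp add: power_mult_distrib)
      ultimately have "(2^n * d n x)\<^sup>2 \<le> E x" by simp
      from real_sqrt_le_mono[OF this] have "\<bar>2^n * d n x\<bar> \<le> sqrt (E x)" by (simp only: real_sqrt_abs)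
      then have "\<bar>d n x\<bar> \<le> sqrt (E x) / 2^n" by (simp add: abs_mult pos_le_divide_eq mult.commute)
      then show "\<bar>d n x\<bar> \<le> sqrt (E x) * (1/2)^n" by (simp add: power_divide)
    qed
  qed
  \<comment> \<open>Where the series diverges this value is unspecified; by \<open>bound\<close>
    that happens only on a null set.\<close>
  define u where "u x = (\<Sum>n. d n x)" for x
  have [measurable]: "u \<in> borel_measurable M" unfolding u_def by measurable
  \<comment> \<open>The geometric tail contributes \<open>(1/2)^m * 2\<close>, whose square is
    \<open>4 * (1/4)^m\<close>.\<close>
  have tail: "AE x in M. (u x - (\<Sum>n<m. d n x))\<^sup>2 \<le> 4 * (1/4)^m * E x" for m
    using bound
  proof eventually_elim
    case (elim x)
    have sg: "summable (\<lambda>n. sqrt (E x) * (1/2)^(n + k))" for k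
      unfolding power_add by (intro summable_mult summable_mult2 summable_geometric) simp
    have sd: "summable (\<lambda>n. \<bar>d (n + k) x\<bar>)" for k
      by (rule summable_comparison_test[OF _ sg[of k]]) (use elim in auto)
    have "u x - (\<Sum>n<m. d n x) = (\<Sum>n. d (n + m) x)"
      unfolding u_def using suminf_minus_initial_segment[of "\<lambda>n. d n x" m] summable_rabs_cancel[OF sd[of 0]] by simp
    also have "\<bar>\<dots>\<bar> \<le> (\<Sum>n. \<bar>d (n + m) x\<bar>)" by (rule summable_rabs[OF sd])
    also have "\<dots> \<le> (\<Sum>n. sqrt (E x) * (1/2)^(n + m))" using elim by (intro suminf_le sd sg) auto
    also have "\<dots> = (\<Sum>n. (sqrt (E x) * (1/2)^m) * (1/2)^n)" by (simp add: power_add mult_ac)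
    also have "\<dots> = (sqrt (E x) * (1/2)^m) * (\<Sum>n. (1/2)^n)" by (rule suminf_mult) simp
    also have "\<dots> = sqrt (E x) * (1/2)^m * 2" by (simp add: suminf_geometric)
    finally have le: "\<bar>u x - (\<Sum>n<m. d n x)\<bar> \<le> sqrt (E x) * (1/2)^m * 2" .
    have "(u x - (\<Sum>n<m. d n x))\<^sup>2 \<le> (sqrt (E x) * (1/2)^m * 2)\<^sup>2"
      using power_mono[OF le abs_ge_zero, of 2] by (simp only: power2_abs)
    also have "\<dots> = 4 * (1/4)^m * E x"
    proof -
      have "((1/2)^m)\<^sup>2 = (1/4::real)^m" unfolding pow4 by (simp add: power2_eq_square)
      then show ?thesis
        using E0[of x] by (simp only: power_mult_distrib real_sqrt_pow2) simp
    qed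
    finally show ?case .
  qed
  have int: "integrable M (\<lambda>x. (u x - (\<Sum>n<m. d n x))\<^sup>2)" for m
    by (rule Bochner_Integration.integrable_bound[where f="\<lambda>x. 4 * (1/4)^m * E x"])
      (use tail[of m] EI E0 in auto)
  have L2: "(\<lambda>x. u x - (\<Sum>n<m. d n x)) \<in> L2 \<Omega>" for m
    using int[of m] by (simp add: L2_def flip: M_def)
  show thesis
  proof
    \<comment> \<open>The case \<open>m = 0\<close>, where the subtracted sum is empty.\<close>
    show "u \<in> L2 \<Omega>" using L2[of 0] by simp
    have le: "(L2_norm \<Omega> (\<lambda>x. u x - (\<Sum>n<m. d n x)))\<^sup>2 \<le> 4 * (1/4)^m * (\<integral>x. E x \<partial>M)" for m
    proof -
      have "(L2_norm \<Omega> (\<lambda>x. u x - (\<Sum>n<m. d n x)))\<^sup>2 = (\<integral>x. (u x - (\<Sum>n<m. d n x))\<^sup>2 \<partial>M)"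
        unfolding L2_norm_power2 by (simp add: L2_inner_def M_def power2_eq_square)
      also have "\<dots> \<le> (\<integral>x. 4 * (1/4)^m * E x \<partial>M)" by (rule integral_mono_AE[OF int]) (use EI tail in auto)
      finally show ?thesis by simp
    qed
    have "(\<lambda>m. (L2_norm \<Omega> (\<lambda>x. u x - (\<Sum>n<m. d n x)))\<^sup>2) \<longlonglongrightarrow> 0"
    proof (rule Lim_null_comparison)
      show "\<forall>\<^sub>F m in sequentially. norm ((L2_norm \<Omega> (\<lambda>x. u x - (\<Sum>n<m. d n x)))\<^sup>2) \<le> 4 * (1/4)^m * (\<integral>x. E x \<partial>M)"
        using le by simp
      show "(\<lambda>m. 4 * (1/4)^m * (\<integral>x. E x \<partial>M)) \<longlonglongrightarrow> 0"
        by (auto intro!: tendsto_eq_intros LIMSEQ_power_zero)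
    qed
    from tendsto_real_sqrt[OF this]
    show "(\<lambda>m. L2_norm \<Omega> (\<lambda>x. u x - (\<Sum>n<m. d n x))) \<longlonglongrightarrow> 0" by (simp add: L2_norm_nonneg)
  qed
qed

section \<open>Orthonormal bases and the control to state map\<close>

lemma orthonormal_basis_L2: "L2_orthonormal_basis \<Omega> \<phi> \<Longrightarrow> \<phi> k \<in> L2 \<Omega>"
  by (simp add: L2_orthonormal_basis_def)

lemma orthonormal_basis_inner:
  "L2_orthonormal_basis \<Omega> \<phi> \<Longrightarrow> L2_inner \<Omega> (\<phi> j) (\<phi> k) = (if j = k then 1 else 0)"
  by (simp add: L2_orthonormal_basis_def)

lemma orthonormal_basis_inner_sum:
  assumes onb: "L2_orthonormal_basis \<Omega> \<phi>" and "finite I"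
  shows "L2_inner \<Omega> (\<lambda>x. \<Sum>k\<in>I. e k * \<phi> k x) (\<phi> j) = (if j \<in> I then e j else 0)"
proof -
  have "L2_inner \<Omega> (\<lambda>x. \<Sum>k\<in>I. e k * \<phi> k x) (\<phi> j) = (\<Sum>k\<in>I. L2_inner \<Omega> (\<lambda>x. e k * \<phi> k x) (\<phi> j))"
    by (intro L2_inner_sum_left L2_scale orthonormal_basis_L2[OF onb])
  also have "\<dots> = (\<Sum>k\<in>I. if k = j then e k else 0)"
    by (intro sum.cong) (simp_all add: L2_inner_scale_left orthonormal_basis_inner[OF onb])
  finally show ?thesis using \<open>finite I\<close> by simp
qed

lemma orthonormal_basis_inner_sum_self:
  assumes onb: "L2_orthonormal_basis \<Omega> \<phi>" and "finite I"
  shows "L2_inner \<Omega> (\<lambda>x. \<Sum>k\<in>I. e k * \<phi> k x) (\<lambda>x. \<Sum>k\<in>I. e k * \<phi> k x) = (\<Sum>k\<in>I. (e k)\<^sup>2)"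
proof -
  let ?P = "\<lambda>x. \<Sum>k\<in>I. e k * \<phi> k x"
  have P: "?P \<in> L2 \<Omega>" by (intro L2_sum L2_scale orthonormal_basis_L2[OF onb])
  have "L2_inner \<Omega> ?P ?P = (\<Sum>k\<in>I. L2_inner \<Omega> (\<lambda>x. e k * \<phi> k x) ?P)"
    by (intro L2_inner_sum_left L2_scale orthonormal_basis_L2[OF onb] P)
  also have "\<dots> = (\<Sum>k\<in>I. (e k)\<^sup>2)"
  proof (rule sum.cong[OF refl])
    fix k assume "k \<in> I"
    then have "L2_inner \<Omega> (\<phi> k) ?P = e k"
      using orthonormal_basis_inner_sum[OF assms, of e k] by (simp add: L2_inner_commute)
    then show "L2_inner \<Omega> (\<lambda>x. e k * \<phi> k x) ?P = (e k)\<^sup>2"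
      by (simp add: L2_inner_scale_left power2_eq_square)
  qed
  finally show ?thesis .
qed

text \<open>Partial sums of the expansion of \<open>w\<close> converge in norm by the definition of
  a basis, so their inner products with \<open>v\<close> converge. The polarized form is what the
  spectral description of the weak equation and of the adjoint calls for.\<close>

lemma L2_Parseval:
  assumes onb: "L2_orthonormal_basis \<Omega> \<phi>" and w: "w \<in> L2 \<Omega>" and v: "v \<in> L2 \<Omega>"
  shows "(\<lambda>k. L2_inner \<Omega> w (\<phi> k) * L2_inner \<Omega> v (\<phi> k)) sums L2_inner \<Omega> w v"
proof -
  let ?P = "\<lambda>N x. \<Sum>k<N. L2_inner \<Omega> w (\<phi> k) * \<phi> k x"
  have "(\<lambda>N. L2_inner \<Omega> (?P N) v) \<longlonglongrightarrow> L2_inner \<Omega> w v"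
  proof (rule L2_inner_tendsto_left[OF _ w v])
    show "(\<lambda>N. L2_norm \<Omega> (\<lambda>x. w x - ?P N x)) \<longlonglongrightarrow> 0"
      using onb w by (simp add: L2_orthonormal_basis_def)
  qed (intro L2_sum L2_scale orthonormal_basis_L2[OF onb])
  moreover have "L2_inner \<Omega> (?P N) v = (\<Sum>k<N. L2_inner \<Omega> w (\<phi> k) * L2_inner \<Omega> v (\<phi> k))" for N
    by (subst L2_inner_sum_left)
      (auto intro: L2_scale orthonormal_basis_L2[OF onb] v simp: L2_inner_scale_left L2_inner_commute[of \<Omega> v])
  ultimately show ?thesis by (simp add: sums_def)
qed

text \<open>Parseval for \<open>u - w\<close> has only zero terms, so the difference has norm
  zero.\<close>

lemma orthonormal_basis_eqI:
  assumes onb: "L2_orthonormal_basis \<Omega> \<phi>" and u: "u \<in> L2 \<Omega>" and w: "w \<in> L2 \<Omega>"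
    and eq: "\<And>k. L2_inner \<Omega> u (\<phi> k) = L2_inner \<Omega> w (\<phi> k)"
  shows "AE x in lebesgue_on \<Omega>. u x = w x"
proof -
  have d: "(\<lambda>x. u x - w x) \<in> L2 \<Omega>" by (rule L2_diff[OF u w])
  have "L2_inner \<Omega> (\<lambda>x. u x - w x) (\<phi> k) = 0" for k
    using eq by (simp add: L2_inner_diff_left u w orthonormal_basis_L2[OF onb])
  then have "(\<lambda>k. 0) sums L2_inner \<Omega> (\<lambda>x. u x - w x) (\<lambda>x. u x - w x)"
    using L2_Parseval[OF onb d d] by simp
  then have "L2_inner \<Omega> (\<lambda>x. u x - w x) (\<lambda>x. u x - w x) = 0" by (metis sums_unique2 sums_zero)
  then show ?thesis using L2_inner_self_eq_0_iff[OF d] by simp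
qed

text \<open>The partial sums are grouped into blocks whose squared norms decay like
  \<open>(1/8)^n\<close>, which is the rate that the completeness lemma asks for. Convergence along
  the block ends is enough to identify every coefficient.\<close>

lemma L2_Riesz_Fischer:
  assumes onb: "L2_orthonormal_basis \<Omega> \<phi>" and e: "summable (\<lambda>k. (e k)\<^sup>2)"
  obtains u where "u \<in> L2 \<Omega>" "\<And>k. L2_inner \<Omega> u (\<phi> k) = e k"
proof -
  have "\<exists>N. \<forall>m\<ge>N. \<forall>n. (\<Sum>k=m..<n. (e k)\<^sup>2) < (1/8)^i" for i :: nat
  proof -
    have "(0::real) < (1/8)^i" by simp
    then obtain N where "\<forall>m\<ge>N. \<forall>n. norm (\<Sum>k=m..<n. (e k)\<^sup>2) < (1/8)^i"
      using e unfolding summable_Cauchy by blast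
    then show ?thesis by (intro exI[of _ N]) (auto simp: sum_nonneg)
  qed
  then obtain r where r: "(\<Sum>k=m..<n. (e k)\<^sup>2) < (1/8)^i" if "m \<ge> r i" for i m n by metis
  \<comment> \<open>Adding \<open>n\<close> and summing the thresholds makes \<open>R\<close>
    monotone and unbounded while it stays above \<open>r n\<close>.\<close>
  define R where "R n = n + (\<Sum>i\<le>n. r i)" for n
  have R_ge: "r n \<le> R n" for n unfolding R_def by (simp add: trans_le_add2 member_le_sum)
  have R_id: "n \<le> R n" for n by (simp add: R_def)
  have R_Suc: "R n \<le> R (Suc n)" for n by (simp add: R_def)
  define P where "P I x = (\<Sum>k\<in>I. e k * \<phi> k x)" for I x
  have P_L2: "P I \<in> L2 \<Omega>" for I
    unfolding P_def by (intro L2_sum L2_scale orthonormal_basis_L2[OF onb])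
  have P_inner: "L2_inner \<Omega> (P I) (\<phi> j) = (if j \<in> I then e j else 0)" if "finite I" for I j
    unfolding P_def by (rule orthonormal_basis_inner_sum[OF onb that])
  have small: "L2_inner \<Omega> (P {R n..<R (Suc n)}) (P {R n..<R (Suc n)}) \<le> (1/8)^n" for n
    unfolding P_def orthonormal_basis_inner_sum_self[OF onb finite_atLeastLessThan]
    using r[OF R_ge] by (rule less_imp_le)
  obtain w where w: "w \<in> L2 \<Omega>"
    and lim: "(\<lambda>m. L2_norm \<Omega> (\<lambda>x. w x - (\<Sum>n<m. P {R n..<R (Suc n)} x))) \<longlonglongrightarrow> 0"
    using L2_complete_series[of "\<lambda>n. P {R n..<R (Suc n)}", OF P_L2 small] by blast
  have telescope: "P {..<R 0} x + (\<Sum>n<m. P {R n..<R (Suc n)} x) = P {..<R m} x" for m x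
  proof (induction m)
    case (Suc m)
    have "P {..<R m} x + P {R m..<R (Suc m)} x = P {..<R (Suc m)} x"
      unfolding P_def lessThan_atLeast0 by (rule sum.atLeastLessThan_concat) (simp_all add: R_Suc)
    with Suc show ?case by simp
  qed simp
  \<comment> \<open>The terms before \<open>R 0\<close> belong to no block and are added back by
    hand.\<close>
  define u where "u x = P {..<R 0} x + w x" for x
  have u: "u \<in> L2 \<Omega>" unfolding u_def by (rule L2_add[OF P_L2 w])
  have "(\<lambda>x. u x - P {..<R m} x) = (\<lambda>x. w x - (\<Sum>n<m. P {R n..<R (Suc n)} x))" for m
    unfolding u_def using telescope[of _ m] by (auto simp: fun_eq_iff algebra_simps)
  with lim have lim': "(\<lambda>m. L2_norm \<Omega> (\<lambda>x. u x - P {..<R m} x)) \<longlonglongrightarrow> 0" by simp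
  have "L2_inner \<Omega> u (\<phi> k) = e k" for k
  proof (rule LIMSEQ_unique)
    show "(\<lambda>m. L2_inner \<Omega> (P {..<R m}) (\<phi> k)) \<longlonglongrightarrow> L2_inner \<Omega> u (\<phi> k)"
      by (rule L2_inner_tendsto_left[OF P_L2 u orthonormal_basis_L2[OF onb] lim'])
    \<comment> \<open>From \<open>m = Suc k\<close> on, \<open>k < m \<le> R m\<close>, so the
      coefficient is already contained in the partial sum and no longer changes.\<close>
    have "L2_inner \<Omega> (P {..<R m}) (\<phi> k) = e k" if "m \<ge> Suc k" for m
      using that R_id[of m] by (simp add: P_inner)
    then show "(\<lambda>m. L2_inner \<Omega> (P {..<R m}) (\<phi> k)) \<longlonglongrightarrow> e k"
      by (intro tendsto_eventually eventually_sequentiallyI)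
  qed
  with u show thesis by (rule that)
qed

section \<open>The weak fractional equation and its solution operator\<close>

text \<open>The defining series has a single nonzero term. Thus basis functions may be used as test
  functions in the weak equation.\<close>

lemma orthonormal_basis_Hs:
  assumes onb: "L2_orthonormal_basis \<Omega> \<phi>"
  shows "\<phi> j \<in> Hs \<Omega> lam \<phi> s"
proof -
  have "summable (\<lambda>k. if k = j then lam k powr s else 0)" by (rule summable_single)
  then have "summable (\<lambda>k. lam k powr s * \<bar>L2_inner \<Omega> (\<phi> j) (\<phi> k)\<bar>\<^sup>2)"
    by (rule summable_cong[THEN iffD1, rotated]) (auto simp: orthonormal_basis_inner[OF onb])
  then show ?thesis by (simp add: Hs_def orthonormal_basis_L2[OF onb])
qed

text \<open>The equation forces the coefficients
  \<open>lam k powr - s * L2_inner \<Omega> z (\<phi> k)\<close>. The lower bound \<mu> on the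
  eigenvalues makes them square summable (\<open>sum2\<close>), so they belong to a function;
  \<open>sum1\<close> is the finiteness of its norm in \<open>Hs\<close>, because the weight
  \<open>lam k powr s\<close> cancels one of the two factors \<open>lam k powr - s\<close>.\<close>

lemma control_to_state_exists:
  assumes onb: "L2_orthonormal_basis \<Omega> \<phi>" and z: "z \<in> L2 \<Omega>"
    and \<mu>: "0 < \<mu>" "\<And>k. \<mu> \<le> lam k" and s: "0 < s"
  shows "\<exists>u. u \<in> Hs \<Omega> lam \<phi> s \<and>
    (\<forall>v \<in> Hs \<Omega> lam \<phi> s. frac_power \<Omega> lam \<phi> s u v = L2_inner \<Omega> z v)"
proof -
  have pos: "0 < lam k" for k using \<mu> by (meson less_le_trans)
  have lam_le: "lam k powr - s \<le> \<mu> powr - s" for k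
    using \<mu> s by (intro powr_mono2') auto
  have zsum: "summable (\<lambda>k. (L2_inner \<Omega> z (\<phi> k))\<^sup>2)"
    using sums_summable[OF L2_Parseval[OF onb z z]] by (simp add: power2_eq_square)
  have sum1: "summable (\<lambda>k. lam k powr - s * (L2_inner \<Omega> z (\<phi> k))\<^sup>2)"
    by (rule summable_comparison_test'[OF summable_mult[OF zsum, of "\<mu> powr - s"]])
      (auto intro!: mult_right_mono lam_le)
  have sum2: "summable (\<lambda>k. (lam k powr - s * L2_inner \<Omega> z (\<phi> k))\<^sup>2)"
  proof (rule summable_comparison_test'[OF summable_mult[OF sum1, of "\<mu> powr - s"]])
    fix k
    have "(lam k powr - s * L2_inner \<Omega> z (\<phi> k))\<^sup>2 =
        lam k powr - s * (lam k powr - s * (L2_inner \<Omega> z (\<phi> k))\<^sup>2)"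
      by (simp add: power2_eq_square mult_ac)
    also have "\<dots> \<le> \<mu> powr - s * (lam k powr - s * (L2_inner \<Omega> z (\<phi> k))\<^sup>2)"
      by (intro mult_right_mono lam_le) simp
    finally show "norm ((lam k powr - s * L2_inner \<Omega> z (\<phi> k))\<^sup>2) \<le>
        \<mu> powr - s * (lam k powr - s * (L2_inner \<Omega> z (\<phi> k))\<^sup>2)" by simp
  qed
  obtain u where u: "u \<in> L2 \<Omega>" and uk: "\<And>k. L2_inner \<Omega> u (\<phi> k) = lam k powr - s * L2_inner \<Omega> z (\<phi> k)"
    using L2_Riesz_Fischer[OF onb sum2] by blast
  have cancel: "lam k powr s * (lam k powr - s * y) = y" for k y
    using pos[of k] by (simp add: powr_minus)
  have "(\<lambda>k. lam k powr s * \<bar>L2_inner \<Omega> u (\<phi> k)\<bar>\<^sup>2) = (\<lambda>k. lam k powr - s * (L2_inner \<Omega> z (\<phi> k))\<^sup>2)"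
    using cancel by (simp add: uk power2_eq_square fun_eq_iff mult.assoc)
  with sum1 u have "u \<in> Hs \<Omega> lam \<phi> s" by (simp add: Hs_def)
  moreover have "frac_power \<Omega> lam \<phi> s u v = L2_inner \<Omega> z v" if "v \<in> Hs \<Omega> lam \<phi> s" for v
  proof -
    have v: "v \<in> L2 \<Omega>" using that by (simp add: Hs_def)
    show ?thesis
      unfolding frac_power_def uk cancel
      using sums_unique[OF L2_Parseval[OF onb z v]] by (simp add: L2_inner_commute[of \<Omega> "\<phi> _" v])
  qed
  ultimately show ?thesis by blast
qed

text \<open>Existence makes the value chosen by \<open>SOME\<close> a solution. Testing its equation
  with \<open>\<phi> k\<close> leaves one term of the series, which is solved for the
  coefficient.\<close>

lemma control_to_state:
  assumes onb: "L2_orthonormal_basis \<Omega> \<phi>" and z: "z \<in> L2 \<Omega>"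
    and \<mu>: "0 < \<mu>" "\<And>k. \<mu> \<le> lam k" and s: "0 < s"
  shows "control_to_state \<Omega> lam \<phi> s z \<in> Hs \<Omega> lam \<phi> s"
    and "L2_inner \<Omega> (control_to_state \<Omega> lam \<phi> s z) (\<phi> k) = lam k powr - s * L2_inner \<Omega> z (\<phi> k)"
proof -
  let ?u = "control_to_state \<Omega> lam \<phi> s z"
  have *: "?u \<in> Hs \<Omega> lam \<phi> s \<and> (\<forall>v \<in> Hs \<Omega> lam \<phi> s. frac_power \<Omega> lam \<phi> s ?u v = L2_inner \<Omega> z v)"
    unfolding control_to_state_def by (rule someI_ex[OF control_to_state_exists[OF assms]])
  then show "?u \<in> Hs \<Omega> lam \<phi> s" by blast
  have "(\<lambda>j. if j = k then lam j powr s * L2_inner \<Omega> ?u (\<phi> j) else 0) sums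
      (lam k powr s * L2_inner \<Omega> ?u (\<phi> k))" by (rule sums_single)
  then have "(\<lambda>j. lam j powr s * L2_inner \<Omega> ?u (\<phi> j) * L2_inner \<Omega> (\<phi> j) (\<phi> k)) sums
      (lam k powr s * L2_inner \<Omega> ?u (\<phi> k))"
    by (rule sums_cong[THEN iffD1, rotated]) (simp add: orthonormal_basis_inner[OF onb])
  then have "frac_power \<Omega> lam \<phi> s ?u (\<phi> k) = lam k powr s * L2_inner \<Omega> ?u (\<phi> k)"
    unfolding frac_power_def by (rule sums_unique[symmetric])
  moreover have "frac_power \<Omega> lam \<phi> s ?u (\<phi> k) = L2_inner \<Omega> z (\<phi> k)"
    using * orthonormal_basis_Hs[OF onb] by blast
  moreover have "0 < lam k" using \<mu> by (meson less_le_trans)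
  ultimately show "L2_inner \<Omega> ?u (\<phi> k) = lam k powr - s * L2_inner \<Omega> z (\<phi> k)"
    by (simp add: powr_minus field_simps)
qed

text \<open>The operator is diagonal with real entries, so both sides have the same Parseval
  series.\<close>

lemma control_to_state_self_adjoint:
  assumes onb: "L2_orthonormal_basis \<Omega> \<phi>" and w: "w \<in> L2 \<Omega>" and v: "v \<in> L2 \<Omega>"
    and \<mu>: "0 < \<mu>" "\<And>k. \<mu> \<le> lam k" and s: "0 < s"
  shows "L2_inner \<Omega> (control_to_state \<Omega> lam \<phi> s w) v = L2_inner \<Omega> w (control_to_state \<Omega> lam \<phi> s v)"
proof -
  note spec = control_to_state[OF onb _ \<mu> s]
  have Sw: "control_to_state \<Omega> lam \<phi> s w \<in> L2 \<Omega>" and Sv: "control_to_state \<Omega> lam \<phi> s v \<in> L2 \<Omega>"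
    using spec(1)[OF w] spec(1)[OF v] by (auto simp: Hs_def)
  show ?thesis
    using L2_Parseval[OF onb Sw v] L2_Parseval[OF onb w Sv]
    by (intro sums_unique2) (simp_all add: spec(2)[OF w] spec(2)[OF v] mult_ac)
qed

text \<open>By self-adjointness the control to state map applied to \<open>w\<close> is a witness
  for the choice in \<open>L2_adjoint\<close>. The chosen \<open>p\<close> may be another
  representative, so only the adjoint identity is recorded.\<close>

lemma control_to_state_adjoint:
  assumes onb: "L2_orthonormal_basis \<Omega> \<phi>" and w: "w \<in> L2 \<Omega>"
    and \<mu>: "0 < \<mu>" "\<And>k. \<mu> \<le> lam k" and s: "0 < s"
  defines "p \<equiv> L2_adjoint \<Omega> (control_to_state \<Omega> lam \<phi> s) w"
  shows "p \<in> L2 \<Omega>"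
    and "v \<in> L2 \<Omega> \<Longrightarrow> L2_inner \<Omega> p v = L2_inner \<Omega> w (control_to_state \<Omega> lam \<phi> s v)"
proof -
  let ?S = "control_to_state \<Omega> lam \<phi> s"
  have "?S w \<in> L2 \<Omega> \<and> (\<forall>v \<in> L2 \<Omega>. L2_inner \<Omega> (?S w) v = L2_inner \<Omega> w (?S v))"
    using control_to_state(1)[OF onb w \<mu> s] control_to_state_self_adjoint[OF onb w _ \<mu> s]
    by (auto simp: Hs_def)
  then have "p \<in> L2 \<Omega> \<and> (\<forall>v \<in> L2 \<Omega>. L2_inner \<Omega> p v = L2_inner \<Omega> w (?S v))"
    unfolding p_def L2_adjoint_def
    by (rule someI[where P="\<lambda>p. p \<in> L2 \<Omega> \<and> (\<forall>v \<in> L2 \<Omega>. L2_inner \<Omega> p v = L2_inner \<Omega> w (?S v))"])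
  then show "p \<in> L2 \<Omega>" "v \<in> L2 \<Omega> \<Longrightarrow> L2_inner \<Omega> p v = L2_inner \<Omega> w (?S v)" by auto
qed

section \<open>A lower bound for the eigenvalues\<close>

lemma C_k_zero: "C_k n (\<lambda>x :: real^'n. 0)"
proof (induction n)
  case (Suc n)
  have "partial_deriv i (\<lambda>x. 0) = (\<lambda>x :: real^'n. 0)" for i :: 'n
    by (simp add: partial_deriv_def fun_eq_iff frechet_derivative_const)
  with Suc show ?case by simp
qed simp

lemma differentiable_on_UNIV_has_derivative:
  "f differentiable_on UNIV \<Longrightarrow> (f has_derivative frechet_derivative f (at x)) (at x)"
  by (simp add: differentiable_on_def frechet_derivative_works)

lemma partial_deriv_eqI: "(f has_derivative f') (at x) \<Longrightarrow> partial_deriv i f x = f' (axis i 1)"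
  unfolding partial_deriv_def by (metis frechet_derivative_at)

lemma C_k_add: "C_k n f \<Longrightarrow> C_k n g \<Longrightarrow> C_k n (\<lambda>x. f x + g x)"
proof (induction n arbitrary: f g)
  case 0
  then show ?case by (simp add: continuous_on_add)
next
  case (Suc n)
  have "partial_deriv i (\<lambda>x. f x + g x) = (\<lambda>x. partial_deriv i f x + partial_deriv i g x)" for i
  proof
    fix x
    have "((\<lambda>x. f x + g x) has_derivative
        (\<lambda>h. frechet_derivative f (at x) h + frechet_derivative g (at x) h)) (at x)"
      using Suc.prems by (intro has_derivative_add differentiable_on_UNIV_has_derivative) auto
    then show "partial_deriv i (\<lambda>x. f x + g x) x = partial_deriv i f x + partial_deriv i g x"
      by (simp add: partial_deriv_eqI) (simp add: partial_deriv_def)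
  qed
  with Suc show ?case by (simp add: differentiable_on_add)
qed

lemma partial_deriv_coordinate_mult:
  assumes "f differentiable_on UNIV"
  shows "partial_deriv i (\<lambda>x. x $ j * f x) x = (if i = j then f x else 0) + x $ j * partial_deriv i f x"
proof -
  have "((\<lambda>x. x $ j * f x) has_derivative
      (\<lambda>h. x $ j * frechet_derivative f (at x) h + h $ j * f x)) (at x)"
    by (intro has_derivative_mult differentiable_on_UNIV_has_derivative[OF assms]
        bounded_linear.has_derivative[OF bounded_linear_vec_nth] has_derivative_ident)
  from partial_deriv_eqI[OF this, of i] show ?thesis
    by (simp add: partial_deriv_def axis_def)
qed

text \<open>A derivative of \<open>x $ j * f x\<close> is again such a product, up to adding
  \<open>f\<close> or 0. The hypothesis covers all orders so that the induction can apply it both to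
  \<open>f\<close> and to its partial derivatives.\<close>

lemma C_k_coordinate_mult:
  fixes f :: "real^'n \<Rightarrow> real"
  assumes "\<And>k. C_k k f"
  shows "C_k n (\<lambda>x. x $ j * f x)"
  using assms
proof (induction n arbitrary: f)
  case 0
  have "continuous_on UNIV f" using 0[of 0] by simp
  then show ?case by (simp add: continuous_intros)
next
  case (Suc n)
  have diff: "f differentiable_on UNIV" using Suc.prems[of "Suc 0"] by simp
  have pd: "C_k k (partial_deriv i f)" for i k using Suc.prems[of "Suc k"] by simp
  have "(\<lambda>x :: real^'n. x $ j) differentiable_on UNIV"
    by (intro bounded_linear_imp_differentiable_on bounded_linear_vec_nth)
  moreover have "C_k n (partial_deriv i (\<lambda>x. x $ j * f x))" for i
  proof -
    have "C_k n (\<lambda>x. if i = j then f x else 0)" 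
      using Suc.prems[of n] by (cases "i = j") (simp_all add: C_k_zero)
    then have "C_k n (\<lambda>x. (if i = j then f x else 0) + x $ j * partial_deriv i f x)"
      by (intro C_k_add Suc.IH pd)
    moreover have "partial_deriv i (\<lambda>x. x $ j * f x) =
        (\<lambda>x. (if i = j then f x else 0) + x $ j * partial_deriv i f x)"
      by (rule ext) (rule partial_deriv_coordinate_mult[OF diff])
    ultimately show ?thesis by (simp only:)
  qed
  ultimately show ?case using diff by simp
qed

text \<open>The coordinate itself has no compact support, but the support of the product is a closed
  subset of that of \<eta>.\<close>

lemma test_functions_coordinate_mult:
  assumes "\<eta> \<in> test_functions \<Omega>"
  shows "(\<lambda>x. x $ j * \<eta> x) \<in> test_functions \<Omega>"
proof -
  have sub: "closure {x. x $ j * \<eta> x \<noteq> 0} \<subseteq> closure {x. \<eta> x \<noteq> 0}" by (rule closure_mono) auto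
  have "compact (closure {x. \<eta> x \<noteq> 0} \<inter> closure {x. x $ j * \<eta> x \<noteq> 0})"
    using assms by (intro compact_Int_closed closed_closure) (simp add: test_functions_def)
  then have "compact (closure {x. x $ j * \<eta> x \<noteq> 0})"
    by (simp only: Int_absorb1[OF sub])
  moreover have "C_k k (\<lambda>x. x $ j * \<eta> x)" for k
    using assms by (intro C_k_coordinate_mult) (simp add: test_functions_def)
  moreover have "closure {x. \<eta> x \<noteq> 0} \<subseteq> \<Omega>" using assms by (simp add: test_functions_def)
  ultimately show ?thesis
    unfolding test_functions_def mem_Collect_eq using sub by (intro conjI allI) (assumption | rule order_trans)+
qed

text \<open>Continuity beyond \<Omega> matters: it gives a bound on the compact closure, whereas a
  function continuous on \<Omega> alone may blow up at the boundary.\<close>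

lemma continuous_on_UNIV_L2:
  assumes "bounded \<Omega>" "open \<Omega>" and f: "continuous_on UNIV f"
  shows "f \<in> L2 \<Omega>"
proof -
  have lm: "\<Omega> \<in> lmeasurable" using assms(1,2) lmeasurable_open by blast
  have m: "f \<in> borel_measurable (lebesgue_on \<Omega>)"
    by (rule continuous_imp_measurable_on_sets_lebesgue[OF continuous_on_subset[OF f]])
      (use lm in \<open>auto simp: fmeasurableD\<close>)
  have "compact (f ` closure \<Omega>)"
    using assms(1) by (intro compact_continuous_image continuous_on_subset[OF f]) auto
  then obtain B where B: "\<And>x. x \<in> \<Omega> \<Longrightarrow> norm (f x) \<le> B"
    using closure_subset unfolding compact_eq_bounded_closed bounded_iff by blast
  have "(\<lambda>x. 1) \<in> L2 \<Omega>" by (rule L2_const[OF lm])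
  moreover have "AE x in lebesgue_on \<Omega>. \<bar>f x\<bar> \<le> B"
    using B by (intro AE_I2) (simp add: space_lebesgue_on)
  ultimately show ?thesis using L2_bounded_mult[OF m] by fastforce
qed

lemma test_functions_L2:
  assumes "bounded \<Omega>" "open \<Omega>" "\<eta> \<in> test_functions \<Omega>"
  shows "\<eta> \<in> L2 \<Omega>" "partial_deriv i \<eta> \<in> L2 \<Omega>"
proof -
  have "C_k 0 \<eta>" "C_k (Suc 0) \<eta>" using assms(3) by (auto simp: test_functions_def)
  then show "\<eta> \<in> L2 \<Omega>" "partial_deriv i \<eta> \<in> L2 \<Omega>"
    by (auto intro: continuous_on_UNIV_L2[OF assms(1,2)])
qed

text \<open>Testing the weak gradient of \<open>w\<close> against \<open>x\<^sub>i \<eta>\<close> and letting \<open>\<eta>\<close> tend to \<open>w\<close> yields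
  \<open>(w, w) = - 2 (x\<^sub>i w, \<partial>\<^sub>i w)\<close>.\<close>

lemma H10_Poincare:
  assumes bd: "bounded \<Omega>" and op: "open \<Omega>" and R: "\<And>x. x \<in> \<Omega> \<Longrightarrow> \<bar>x $ i\<bar> \<le> R" and R0: "0 \<le> R"
    and w: "w \<in> H10 \<Omega>"
  obtains G where "has_weak_gradient \<Omega> w G" "L2_inner \<Omega> w w \<le> 2 * (R * L2_norm \<Omega> w * L2_norm \<Omega> (\<lambda>x. G x $ i))"
proof -
  obtain G where wL2: "w \<in> L2 \<Omega>" and G: "has_weak_gradient \<Omega> w G"
    and approx: "\<And>\<epsilon>. \<epsilon> > 0 \<Longrightarrow> \<exists>\<eta> \<in> test_functions \<Omega>.
           sqrt ((L2_norm \<Omega> (\<lambda>x. w x - \<eta> x))\<^sup>2 +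
                 (\<Sum>i\<in>UNIV. (L2_norm \<Omega> (\<lambda>x. G x $ i - partial_deriv i \<eta> x))\<^sup>2)) < \<epsilon>"
    using w unfolding H10_def by auto
  define err where "err \<eta> = sqrt ((L2_norm \<Omega> (\<lambda>x. w x - \<eta> x))\<^sup>2 +
      (\<Sum>i\<in>UNIV. (L2_norm \<Omega> (\<lambda>x. G x $ i - partial_deriv i \<eta> x))\<^sup>2))" for \<eta>
  have "\<exists>\<eta> \<in> test_functions \<Omega>. err \<eta> < inverse (real (Suc n))" for n
    unfolding err_def by (rule approx) simp
  then obtain \<eta> where \<eta>: "\<And>n. \<eta> n \<in> test_functions \<Omega>"
    and close: "\<And>n. err (\<eta> n) < inverse (real (Suc n))"
    by metis
  let ?g = "\<lambda>x. G x $ i" and ?d = "\<lambda>n. partial_deriv i (\<eta> n)"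
  have gL2: "?g \<in> L2 \<Omega>" using G by (simp add: has_weak_gradient_def)
  note \<eta>L2 = test_functions_L2[OF bd op \<eta>]
  \<comment> \<open>\<open>err\<close> dominates both the error of the function and that of its
    derivative in direction \<open>i\<close>, so one sandwich argument serves both limits.\<close>
  have lim: "f \<longlonglongrightarrow> 0" if "\<And>n. 0 \<le> f n" "\<And>n. f n \<le> err (\<eta> n)" for f
  proof (rule real_tendsto_sandwich[OF _ _ tendsto_const LIMSEQ_inverse_real_of_nat])
    show "\<forall>\<^sub>F n in sequentially. f n \<le> inverse (real (Suc n))"
      using order_trans[OF that(2) less_imp_le[OF close]] by simp
  qed (use that(1) in simp)
  have limw: "(\<lambda>n. L2_norm \<Omega> (\<lambda>x. w x - \<eta> n x)) \<longlonglongrightarrow> 0"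
    by (intro lim L2_norm_nonneg) (simp add: err_def real_le_rsqrt sum_nonneg)
  have limg: "(\<lambda>n. L2_norm \<Omega> (\<lambda>x. ?g x - ?d n x)) \<longlonglongrightarrow> 0"
  proof (intro lim L2_norm_nonneg)
    fix n
    have "(L2_norm \<Omega> (\<lambda>x. ?g x - ?d n x))\<^sup>2 \<le>
        (\<Sum>i\<in>UNIV. (L2_norm \<Omega> (\<lambda>x. G x $ i - partial_deriv i (\<eta> n) x))\<^sup>2)"
      by (rule member_le_sum) auto
    then show "L2_norm \<Omega> (\<lambda>x. ?g x - ?d n x) \<le> err (\<eta> n)"
      unfolding err_def by (intro real_le_rsqrt) (simp add: add_increasing)
  qed
  have "\<Omega> \<in> sets lebesgue" using op by (simp add: borel_open)
  then have xm: "(\<lambda>x. x $ i) \<in> borel_measurable (lebesgue_on \<Omega>)"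
    by (intro continuous_imp_measurable_on_sets_lebesgue continuous_intros)
  have xB: "AE x in lebesgue_on \<Omega>. \<bar>x $ i\<bar> \<le> R" using R by (intro AE_I2) (simp add: space_lebesgue_on)
  note mult_L2 = L2_bounded_mult[OF xm xB]
  have swap: "L2_inner \<Omega> f (\<lambda>x. x $ i * g x) = L2_inner \<Omega> g (\<lambda>x. x $ i * f x)" for f g
    by (simp add: L2_inner_def mult_ac)
  \<comment> \<open>The derivative of the coordinate is 1, so the product rule reproduces
    \<open>\<eta> n\<close> itself. The coordinate factor is moved by \<open>swap\<close> onto the
    fixed functions \<open>w\<close> and \<open>?g\<close>, which leaves a plain sequence in the
    left argument of each inner product.\<close>
  have identity: "L2_inner \<Omega> (\<eta> n) w + L2_inner \<Omega> (?d n) (\<lambda>x. x $ i * w x) =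
      - L2_inner \<Omega> (\<eta> n) (\<lambda>x. x $ i * ?g x)" for n
  proof -
    have "C_k (Suc 0) (\<eta> n)" using \<eta>[of n] by (simp only: test_functions_def) blast
    then have diff: "\<eta> n differentiable_on UNIV" by simp
    have "L2_inner \<Omega> w (partial_deriv i (\<lambda>x. x $ i * \<eta> n x)) = - L2_inner \<Omega> ?g (\<lambda>x. x $ i * \<eta> n x)"
      using G test_functions_coordinate_mult[OF \<eta>] by (auto simp: has_weak_gradient_def)
    moreover have "partial_deriv i (\<lambda>x. x $ i * \<eta> n x) = (\<lambda>x. \<eta> n x + x $ i * ?d n x)"
      by (simp add: fun_eq_iff partial_deriv_coordinate_mult[OF diff])
    ultimately show ?thesis
      using L2_inner_add_right[OF \<eta>L2(1)[of n] mult_L2[OF \<eta>L2(2)[of i n]] wL2]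
        swap[of w "?d n"] swap[of ?g "\<eta> n"] L2_inner_commute[of \<Omega> w "\<eta> n"]
      by simp
  qed
  have "(\<lambda>n. L2_inner \<Omega> (\<eta> n) w + L2_inner \<Omega> (?d n) (\<lambda>x. x $ i * w x))
      \<longlonglongrightarrow> L2_inner \<Omega> w w + L2_inner \<Omega> ?g (\<lambda>x. x $ i * w x)"
    by (intro tendsto_add L2_inner_tendsto_left \<eta>L2 wL2 gL2 mult_L2 limw limg)
  moreover have "(\<lambda>n. - L2_inner \<Omega> (\<eta> n) (\<lambda>x. x $ i * ?g x)) \<longlonglongrightarrow> - L2_inner \<Omega> w (\<lambda>x. x $ i * ?g x)"
    by (intro tendsto_minus L2_inner_tendsto_left \<eta>L2 wL2 gL2 mult_L2 limw)
  ultimately have "L2_inner \<Omega> w w + L2_inner \<Omega> ?g (\<lambda>x. x $ i * w x) = - L2_inner \<Omega> w (\<lambda>x. x $ i * ?g x)"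
    unfolding identity by (rule LIMSEQ_unique)
  \<comment> \<open>By \<open>swap\<close> both gradient terms are the same number, whence the
    factor 2.\<close>
  then have "L2_inner \<Omega> w w = - 2 * L2_inner \<Omega> (\<lambda>x. x $ i * w x) ?g"
    using swap[of w ?g] L2_inner_commute[of \<Omega> "\<lambda>x. x $ i * w x" ?g] by simp
  then have le: "L2_inner \<Omega> w w \<le> 2 * (L2_norm \<Omega> (\<lambda>x. x $ i * w x) * L2_norm \<Omega> ?g)"
    using L2_Cauchy_Schwarz[OF mult_L2[OF wL2] gL2] by linarith
  have "L2_inner \<Omega> (\<lambda>x. x $ i * w x) (\<lambda>x. x $ i * w x) \<le> L2_inner \<Omega> (\<lambda>x. R * w x) (\<lambda>x. R * w x)"
    unfolding L2_inner_def
  proof (rule integral_mono_AE)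
    show "AE x in lebesgue_on \<Omega>. x $ i * w x * (x $ i * w x) \<le> R * w x * (R * w x)"
      using xB
    proof eventually_elim
      case (elim x)
      then have "(x $ i)\<^sup>2 \<le> R\<^sup>2" using R0 abs_le_square_iff[of "x $ i" R] by simp
      then have "(x $ i)\<^sup>2 * (w x)\<^sup>2 \<le> R\<^sup>2 * (w x)\<^sup>2" by (rule mult_right_mono) simp
      then show ?case by (simp only: power2_eq_square mult_ac)
    qed
  qed (intro L2_integrable_mult mult_L2 L2_scale wL2)+
  then have "L2_norm \<Omega> (\<lambda>x. x $ i * w x) \<le> L2_norm \<Omega> (\<lambda>x. R * w x)" by (simp add: L2_norm_def)
  also have "L2_norm \<Omega> (\<lambda>x. R * w x) = R * L2_norm \<Omega> w"
    using R0 by (simp add: L2_norm_def L2_inner_scale_left L2_inner_scale_right real_sqrt_mult)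
  finally have "L2_norm \<Omega> (\<lambda>x. x $ i * w x) * L2_norm \<Omega> ?g \<le> R * L2_norm \<Omega> w * L2_norm \<Omega> ?g"
    by (rule mult_right_mono[OF _ L2_norm_nonneg])
  with le have "L2_inner \<Omega> w w \<le> 2 * (R * L2_norm \<Omega> w * L2_norm \<Omega> ?g)" by linarith
  with G show thesis by (rule that)
qed

text \<open>Testing the eigenvalue equation with the normalized eigenfunction shows that
  \<open>l\<close> is at least \<alpha> times the squared norm of one partial derivative, and the
  Poincare inequality bounds that norm from below. The bound involves only the domain and \<alpha>,
  hence it is uniform over all eigenpairs.\<close>

lemma eigenvalues_bounded_below:
  assumes bd: "bounded \<Omega>" and op: "open \<Omega>" and A: "elliptic_coefficients \<Omega> A c"
  obtains \<mu> where "0 < \<mu>"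
    "\<And>l w. eigenpair \<Omega> A c l w \<Longrightarrow> 0 < l \<Longrightarrow> L2_inner \<Omega> w w = 1 \<Longrightarrow> \<mu> \<le> l"
proof -
  \<comment> \<open>Any single direction will do, since one component is bounded by the norm of the
    gradient.\<close>
  fix i :: 'a
  obtain R0 where R0: "\<And>x. x \<in> \<Omega> \<Longrightarrow> norm x \<le> R0" using bd unfolding bounded_iff by blast
  define R where "R = \<bar>R0\<bar> + 1"
  have R: "\<bar>x $ i\<bar> \<le> R" if "x \<in> \<Omega>" for x
    using component_le_norm_cart[of x i] R0[OF that] by (simp add: R_def)
  have Rpos: "0 < R" by (simp add: R_def)
  obtain \<alpha> where \<alpha>: "0 < \<alpha>" "\<And>x \<xi>. x \<in> \<Omega> \<Longrightarrow> \<alpha> * (norm \<xi>)\<^sup>2 \<le> (A x *v \<xi>) \<bullet> \<xi>"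
    using A unfolding elliptic_coefficients_def by blast
  have c0: "AE x in lebesgue_on \<Omega>. 0 \<le> c x" using A by (simp add: elliptic_coefficients_def)
  show thesis
  proof
    show "0 < \<alpha> / (2 * R)\<^sup>2" using \<alpha> Rpos by simp
    fix l w
    assume ev: "eigenpair \<Omega> A c l w" and l: "0 < l" and w1: "L2_inner \<Omega> w w = 1"
    have w: "w \<in> H10 \<Omega>" using ev by (simp add: eigenpair_def)
    obtain G where G: "has_weak_gradient \<Omega> w G"
      and P: "L2_inner \<Omega> w w \<le> 2 * (R * L2_norm \<Omega> w * L2_norm \<Omega> (\<lambda>x. G x $ i))"
      using H10_Poincare[OF bd op R less_imp_le[OF Rpos] w] by blast
    have gL2: "(\<lambda>x. G x $ i) \<in> L2 \<Omega>" using G by (simp add: has_weak_gradient_def)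
    have "L2_norm \<Omega> w = 1" using w1 by (simp add: L2_norm_def)
    then have "1 \<le> 2 * R * L2_norm \<Omega> (\<lambda>x. G x $ i)" using P w1 by simp
    then have "1 \<le> (2 * R * L2_norm \<Omega> (\<lambda>x. G x $ i))\<^sup>2" by (rule one_le_power)
    then have 1: "1 \<le> (2 * R)\<^sup>2 * L2_inner \<Omega> (\<lambda>x. G x $ i) (\<lambda>x. G x $ i)"
      by (simp only: power_mult_distrib L2_norm_power2)
    let ?h = "\<lambda>x. (A x *v G x) \<bullet> G x + c x * w x * w x"
    have "(\<integral>x. ?h x \<partial>lebesgue_on \<Omega>) = l * L2_inner \<Omega> w w"
      using ev w G unfolding eigenpair_def by blast
    then have int: "(\<integral>x. ?h x \<partial>lebesgue_on \<Omega>) = l" by (simp only: w1 mult_1_right)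
    \<comment> \<open>The integral of a nonintegrable function is 0 by convention, whereas this one
      equals \<open>l > 0\<close>; so integrability can be read off the equation.\<close>
    have hint: "integrable (lebesgue_on \<Omega>) ?h"
    proof (rule ccontr)
      assume "\<not> integrable (lebesgue_on \<Omega>) ?h"
      from not_integrable_integral_eq[OF this] show False using int l by linarith
    qed
    have "\<alpha> * L2_inner \<Omega> (\<lambda>x. G x $ i) (\<lambda>x. G x $ i) = (\<integral>x. \<alpha> * (G x $ i * G x $ i) \<partial>lebesgue_on \<Omega>)"
      by (simp add: L2_inner_def)
    also have "\<dots> \<le> (\<integral>x. ?h x \<partial>lebesgue_on \<Omega>)"
    proof (rule integral_mono_AE[OF _ hint])
      show "integrable (lebesgue_on \<Omega>) (\<lambda>x. \<alpha> * (G x $ i * G x $ i))"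
        using L2_integrable_mult[OF gL2 gL2] by simp
      show "AE x in lebesgue_on \<Omega>. \<alpha> * (G x $ i * G x $ i) \<le> ?h x"
        using c0 AE_space
      proof eventually_elim
        case (elim x)
        have "\<bar>G x $ i\<bar>\<^sup>2 \<le> (norm (G x))\<^sup>2" by (intro power_mono component_le_norm_cart) simp
        then have "\<alpha> * (G x $ i * G x $ i) \<le> \<alpha> * (norm (G x))\<^sup>2"
          using \<alpha>(1) by (intro mult_left_mono) (simp_all only: power2_eq_square abs_mult_self_eq less_imp_le)
        also have "\<dots> \<le> (A x *v G x) \<bullet> G x" using elim(2) by (intro \<alpha>(2)) (simp add: space_lebesgue_on)
        also have "\<dots> \<le> ?h x" using mult_nonneg_nonneg[OF elim(1) zero_le_square[of "w x"]] by (simp only: mult.assoc)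
        finally show ?case .
      qed
    qed
    finally have 2: "\<alpha> * L2_inner \<Omega> (\<lambda>x. G x $ i) (\<lambda>x. G x $ i) \<le> l" by (simp only: int)
    have "\<alpha> * 1 \<le> \<alpha> * ((2 * R)\<^sup>2 * L2_inner \<Omega> (\<lambda>x. G x $ i) (\<lambda>x. G x $ i))"
      using 1 \<alpha>(1) by (intro mult_left_mono) auto
    also have "\<dots> = (2 * R)\<^sup>2 * (\<alpha> * L2_inner \<Omega> (\<lambda>x. G x $ i) (\<lambda>x. G x $ i))" by (simp only: mult_ac)
    also have "\<dots> \<le> (2 * R)\<^sup>2 * l" by (intro mult_left_mono 2) simp
    finally show "\<alpha> / (2 * R)\<^sup>2 \<le> l" 
      using zero_less_power[of "2 * R" 2] Rpos by (simp only: pos_divide_le_eq mult.commute)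
  qed
qed

section \<open>First-order optimality\<close>

lemma Zad_convex:
  assumes z: "z \<in> Zad \<Omega> a b" and y: "y \<in> Zad \<Omega> a b" and t: "0 \<le> t" "t \<le> 1"
  shows "(\<lambda>x. z x + t * (y x - z x)) \<in> Zad \<Omega> a b"
proof -
  have zL2: "z \<in> L2 \<Omega>" and yL2: "y \<in> L2 \<Omega>" using z y by (auto simp: Zad_def)
  have "AE x in lebesgue_on \<Omega>. a \<le> z x \<and> z x \<le> b" "AE x in lebesgue_on \<Omega>. a \<le> y x \<and> y x \<le> b"
    using z y by (auto simp: Zad_def)
  then have "AE x in lebesgue_on \<Omega>. a \<le> z x + t * (y x - z x) \<and> z x + t * (y x - z x) \<le> b"
  proof eventually_elim
    case (elim x)
    have "z x + t * (y x - z x) = (1 - t) * z x + t * y x" by (simp add: algebra_simps)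
    moreover have "(1 - t) * a + t * a \<le> (1 - t) * z x + t * y x"
      using elim t by (intro add_mono mult_left_mono) auto
    moreover have "(1 - t) * z x + t * y x \<le> (1 - t) * b + t * b"
      using elim t by (intro add_mono mult_left_mono) auto
    moreover have "(1 - t) * a + t * a = a" "(1 - t) * b + t * b = b" by (simp_all add: algebra_simps)
    ultimately show ?case by simp
  qed
  moreover have "(\<lambda>x. z x + t * (y x - z x)) \<in> L2 \<Omega>" by (intro L2_add L2_scale L2_diff zL2 yL2)
  ultimately show ?thesis by (simp add: Zad_def)
qed

lemma L2_subset_L1:
  assumes "\<Omega> \<in> lmeasurable" and "f \<in> L2 \<Omega>"
  shows "f \<in> L1 \<Omega>"
  using L2_integrable_mult[OF assms(2) L2_const[OF assms(1), of 1]] by (simp add: L1_def)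

lemma Linf_subset_L2:
  assumes \<Omega>: "\<Omega> \<in> lmeasurable" and f: "f \<in> Linf \<Omega>"
  shows "f \<in> L2 \<Omega>"
proof -
  obtain B where "f \<in> borel_measurable (lebesgue_on \<Omega>)" "AE x in lebesgue_on \<Omega>. \<bar>f x\<bar> \<le> B"
    using f by (auto simp: Linf_def)
  from L2_bounded_mult[OF this L2_const[OF \<Omega>, of 1]] show ?thesis by simp
qed

text \<open>Convexity is put as a bound on the increment with an explicit factor \<open>t\<close>,
  so that it can be divided by the step size.\<close>

lemma L1_norm_convex:
  assumes z: "z \<in> L1 \<Omega>" and y: "y \<in> L1 \<Omega>" and t: "0 \<le> t" "t \<le> 1"
  shows "L1_norm \<Omega> (\<lambda>x. z x + t * (y x - z x)) \<le> L1_norm \<Omega> z + t * (L1_norm \<Omega> y - L1_norm \<Omega> z)"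
proof -
  have zi: "integrable (lebesgue_on \<Omega>) z" and yi: "integrable (lebesgue_on \<Omega>) y"
    using z y by (auto simp: L1_def)
  have "L1_norm \<Omega> (\<lambda>x. z x + t * (y x - z x)) \<le> (\<integral>x. \<bar>z x\<bar> + t * (\<bar>y x\<bar> - \<bar>z x\<bar>) \<partial>lebesgue_on \<Omega>)"
    unfolding L1_norm_def
  proof (rule integral_mono)
    fix x
    have "\<bar>z x + t * (y x - z x)\<bar> = \<bar>(1 - t) * z x + t * y x\<bar>" by (simp add: algebra_simps)
    also have "\<dots> \<le> (1 - t) * \<bar>z x\<bar> + t * \<bar>y x\<bar>"
      using abs_triangle_ineq[of "(1 - t) * z x" "t * y x"] t by (simp add: abs_mult)
    also have "\<dots> = \<bar>z x\<bar> + t * (\<bar>y x\<bar> - \<bar>z x\<bar>)" by (simp add: algebra_simps)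
    finally show "\<bar>z x + t * (y x - z x)\<bar> \<le> \<bar>z x\<bar> + t * (\<bar>y x\<bar> - \<bar>z x\<bar>)" .
  qed (use zi yi in auto)
  also have "\<dots> = L1_norm \<Omega> z + t * (L1_norm \<Omega> y - L1_norm \<Omega> z)"
    using zi yi by (simp add: L1_norm_def)
  finally show ?thesis .
qed

text \<open>Replacing \<open>z\<close> by \<open>zbar\<close> wherever the integrand is nonnegative stays admissible.\<close>

lemma Zad_localize:
  assumes \<Omega>: "\<Omega> \<in> lmeasurable" and q: "q \<in> L2 \<Omega>" and zbar: "zbar \<in> Zad \<Omega> a b" and z: "z \<in> Zad \<Omega> a b"
    and min: "\<And>y. y \<in> Zad \<Omega> a b \<Longrightarrow>
      0 \<le> L2_inner \<Omega> q (\<lambda>x. y x - zbar x) + \<nu> * (L1_norm \<Omega> y - L1_norm \<Omega> zbar)"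
  shows "AE x in lebesgue_on \<Omega>. 0 \<le> q x * (z x - zbar x) + \<nu> * (\<bar>z x\<bar> - \<bar>zbar x\<bar>)"
proof -
  define M where "M = lebesgue_on \<Omega>"
  define g where "g x = q x * (z x - zbar x) + \<nu> * (\<bar>z x\<bar> - \<bar>zbar x\<bar>)" for x
  have zL2: "z \<in> L2 \<Omega>" and zbarL2: "zbar \<in> L2 \<Omega>" using z zbar by (auto simp: Zad_def)
  have [measurable]: "q \<in> borel_measurable M" "z \<in> borel_measurable M" "zbar \<in> borel_measurable M"
    using q zL2 zbarL2 by (auto simp: M_def L2_measurable)
  have [measurable]: "g \<in> borel_measurable M" unfolding g_def by measurable
  have L2_i: "integrable M (\<lambda>x. \<bar>f x\<bar>)" if "f \<in> L2 \<Omega>" for f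
    using L2_subset_L1[OF \<Omega> that] by (simp add: L1_def M_def)
  have gi: "integrable M (\<lambda>x. q x * (y x - zbar x) + \<nu> * (\<bar>y x\<bar> - \<bar>zbar x\<bar>))" if "y \<in> L2 \<Omega>" for y
    using L2_integrable_mult[OF q L2_diff[OF that zbarL2]] L2_i[OF that] L2_i[OF zbarL2]
    by (simp flip: M_def)
  have int: "(\<integral>x. q x * (y x - zbar x) + \<nu> * (\<bar>y x\<bar> - \<bar>zbar x\<bar>) \<partial>M) =
      L2_inner \<Omega> q (\<lambda>x. y x - zbar x) + \<nu> * (L1_norm \<Omega> y - L1_norm \<Omega> zbar)" if "y \<in> L2 \<Omega>" for y
    using L2_integrable_mult[OF q L2_diff[OF that zbarL2]] L2_i[OF that] L2_i[OF zbarL2]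
    by (simp add: L2_inner_def L1_norm_def flip: M_def)
  define h where "h x = (if g x < 0 then z x else zbar x)" for x
  have hm [measurable]: "h \<in> borel_measurable M" unfolding h_def by measurable
  have "integrable M (\<lambda>x. (h x)\<^sup>2)"
  proof (rule Bochner_Integration.integrable_bound)
    show "integrable M (\<lambda>x. (z x)\<^sup>2 + (zbar x)\<^sup>2)"
      using L2_integrable_power2[OF zL2] L2_integrable_power2[OF zbarL2] by (simp add: M_def)
  qed (auto simp: h_def)
  then have hL2: "h \<in> L2 \<Omega>" using hm by (simp add: L2_def M_def)
  have "AE x in M. a \<le> z x \<and> z x \<le> b" "AE x in M. a \<le> zbar x \<and> zbar x \<le> b"
    using z zbar by (simp_all only: Zad_def M_def mem_Collect_eq)
  then have "AE x in M. a \<le> h x \<and> h x \<le> b" by eventually_elim (simp add: h_def)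
  with hL2 have "h \<in> Zad \<Omega> a b" unfolding Zad_def M_def by blast
  from min[OF this] have "0 \<le> (\<integral>x. q x * (h x - zbar x) + \<nu> * (\<bar>h x\<bar> - \<bar>zbar x\<bar>) \<partial>M)"
    by (simp only: int[OF hL2])
  \<comment> \<open>Passing to \<open>h\<close> keeps the integrand \<open>g\<close> where it is
    negative and replaces it by 0 elsewhere. A nonpositive function with nonnegative integral
    vanishes almost everywhere.\<close>
  also have "(\<lambda>x. q x * (h x - zbar x) + \<nu> * (\<bar>h x\<bar> - \<bar>zbar x\<bar>)) = (\<lambda>x. - max (- g x) 0)"
    by (auto simp: h_def g_def max_def fun_eq_iff)
  finally have "(\<integral>x. max (- g x) 0 \<partial>M) \<le> 0" by simp
  moreover have mi: "integrable M (\<lambda>x. max (- g x) 0)" using gi[OF zL2] by (simp flip: g_def)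
  ultimately have "(\<integral>x. max (- g x) 0 \<partial>M) = 0" by (intro antisym integral_nonneg_AE) auto
  then have "AE x in M. max (- g x) 0 = 0" using integral_nonneg_eq_0_iff_AE[OF mi] by auto
  then show ?thesis unfolding M_def g_def by eventually_elim (simp add: max_def split: if_splits)
qed

text \<open>Only the constant competitors \<open>0\<close>, \<open>a\<close> and \<open>b\<close> are needed. Where \<open>zbar\<close> vanishes they give
  \<open>\<bar>q\<bar> \<le> \<nu>\<close>, so that \<open>- q / \<nu>\<close> is an admissible value of the subgradient.\<close>

lemma L1_multiplier:
  assumes \<Omega>: "\<Omega> \<in> lmeasurable" and q: "q \<in> L2 \<Omega>" and zbar: "zbar \<in> Zad \<Omega> a b"
    and ab: "a < 0" "0 < b" and \<nu>: "0 < \<nu>"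
    and min: "\<And>y. y \<in> Zad \<Omega> a b \<Longrightarrow>
      0 \<le> L2_inner \<Omega> q (\<lambda>x. y x - zbar x) + \<nu> * (L1_norm \<Omega> y - L1_norm \<Omega> zbar)"
  obtains l where "l \<in> L1_subdifferential \<Omega> (L1_norm \<Omega>) zbar"
    "\<And>z. z \<in> Zad \<Omega> a b \<Longrightarrow> 0 \<le> L2_inner \<Omega> (\<lambda>x. q x + \<nu> * l x) (\<lambda>x. z x - zbar x)"
proof -
  have zbarL2: "zbar \<in> L2 \<Omega>" using zbar by (simp add: Zad_def)
  have [measurable]: "q \<in> borel_measurable (lebesgue_on \<Omega>)" "zbar \<in> borel_measurable (lebesgue_on \<Omega>)"
    using q zbarL2 by (auto simp: L2_measurable)
  define l where "l x = (if zbar x > 0 then 1 else if zbar x < 0 then - 1 else - q x / \<nu>)" for x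
  have const: "(\<lambda>x. r) \<in> Zad \<Omega> a b" if "a \<le> r" "r \<le> b" for r
    using that by (simp add: Zad_def L2_const[OF \<Omega>])
  have local: "AE x in lebesgue_on \<Omega>. 0 \<le> q x * (r - zbar x) + \<nu> * (\<bar>r\<bar> - \<bar>zbar x\<bar>)"
    if "a \<le> r" "r \<le> b" for r
    by (rule Zad_localize[OF \<Omega> q zbar const[OF that] min])
  have "AE x in lebesgue_on \<Omega>. 0 \<le> q x * (0 - zbar x) + \<nu> * (\<bar>0\<bar> - \<bar>zbar x\<bar>)"
    "AE x in lebesgue_on \<Omega>. 0 \<le> q x * (a - zbar x) + \<nu> * (\<bar>a\<bar> - \<bar>zbar x\<bar>)"
    "AE x in lebesgue_on \<Omega>. 0 \<le> q x * (b - zbar x) + \<nu> * (\<bar>b\<bar> - \<bar>zbar x\<bar>)"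
    using ab by (intro local; simp)+
  moreover have "AE x in lebesgue_on \<Omega>. a \<le> zbar x \<and> zbar x \<le> b" using zbar by (simp add: Zad_def)
  \<comment> \<open>The quantifier over \<open>r\<close> stands inside the almost-everywhere
    statement: a single null set serves all \<open>r\<close>, and \<open>r\<close> may later be
    replaced by \<open>z x\<close>.\<close>
  ultimately have pointwise: "AE x in lebesgue_on \<Omega>. (zbar x = 0 \<longrightarrow> \<bar>q x\<bar> \<le> \<nu>) \<and>
      (\<forall>r\<in>{a..b}. 0 \<le> (q x + \<nu> * l x) * (r - zbar x))"
  proof eventually_elim
    case (elim x)
    note 0 = elim(1) and A = elim(2) and B = elim(3) and bounds = elim(4)
    consider (pos) "zbar x > 0" | (neg) "zbar x < 0" | (zero) "zbar x = 0" by linarith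
    then show ?case
    proof cases
      case pos
      \<comment> \<open>The competitor 0 gives \<open>q x + \<nu> \<le> 0\<close>, and the
        competitor \<open>b\<close> then leaves only equality or an active bound
        \<open>zbar x = b\<close>. In either case the product with \<open>r - zbar x\<close> is
        nonnegative. The negative case is the mirror image with \<open>a\<close>.\<close>
      have "(q x + \<nu>) * zbar x \<le> 0" using 0 pos by (simp add: algebra_simps)
      then have le: "q x + \<nu> \<le> 0" using pos by (simp add: mult_le_0_iff)
      have "0 \<le> (q x + \<nu>) * (b - zbar x)" using B pos ab by (simp add: algebra_simps)
      then have or: "q x + \<nu> = 0 \<or> zbar x = b"
        using le bounds by (auto simp: zero_le_mult_iff)
      have "0 \<le> (q x + \<nu>) * (r - zbar x)" if "r \<le> b" for r
        using or le that by (auto intro: mult_nonpos_nonpos)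
      then show ?thesis using pos by (simp add: l_def)
    next
      case neg
      have "0 \<le> (q x - \<nu>) * (- zbar x)" using 0 neg by (simp add: algebra_simps)
      then have ge: "q x - \<nu> \<ge> 0" using neg by (simp add: zero_le_mult_iff mult_le_0_iff)
      have "0 \<le> (q x - \<nu>) * (a - zbar x)" using A neg ab by (simp add: algebra_simps)
      then have or: "q x - \<nu> = 0 \<or> zbar x = a"
        using ge bounds by (auto simp: zero_le_mult_iff)
      have "0 \<le> (q x - \<nu>) * (r - zbar x)" if "a \<le> r" for r
        using or ge that by (auto intro: mult_nonneg_nonneg)
      then show ?thesis using neg by (simp add: l_def)
    next
      case zero
      have "0 \<le> (q x + \<nu>) * b" using B zero ab by (simp add: algebra_simps)
      then have ge: "- \<nu> \<le> q x" using ab by (simp add: zero_le_mult_iff)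
      have "0 \<le> (q x - \<nu>) * a" using A zero ab by (simp add: algebra_simps)
      then have le: "q x \<le> \<nu>" using ab by (simp add: zero_le_mult_iff)
      show ?thesis using zero ge le \<nu> by (simp add: l_def)
    qed
  qed
  have lm: "l \<in> borel_measurable (lebesgue_on \<Omega>)" unfolding l_def by measurable
  have lsub: "l \<in> L1_subdifferential \<Omega> (L1_norm \<Omega>) zbar"
    unfolding L1_norm_subdifferential_iff[OF \<Omega> L2_subset_L1[OF \<Omega> zbarL2]]
  proof
    \<comment> \<open>On a null set \<open>- q x / \<nu>\<close> may leave \<open>{- 1..1}\<close>;
      the pointwise description of the subdifferential tolerates this.\<close>
    show "AE x in lebesgue_on \<Omega>. (zbar x > 0 \<longrightarrow> l x = 1) \<and> (zbar x < 0 \<longrightarrow> l x = - 1) \<and>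
        (zbar x = 0 \<longrightarrow> l x \<in> {- 1..1})"
      using pointwise
    proof eventually_elim
      case (elim x)
      then show ?case using \<nu> by (auto simp: l_def field_simps abs_le_iff)
    qed
  qed (rule lm)
  show thesis
  proof (rule that[OF lsub])
    fix z assume z: "z \<in> Zad \<Omega> a b"
    then have "AE x in lebesgue_on \<Omega>. a \<le> z x \<and> z x \<le> b" by (simp add: Zad_def)
    then have "AE x in lebesgue_on \<Omega>. 0 \<le> (q x + \<nu> * l x) * (z x - zbar x)"
      using pointwise by eventually_elim auto
    then show "0 \<le> L2_inner \<Omega> (\<lambda>x. q x + \<nu> * l x) (\<lambda>x. z x - zbar x)"
      unfolding L2_inner_def by (rule integral_nonneg_AE)
  qed
qed

section \<open>The cost as a function of the control alone\<close>

lemma cost_cong_AE: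
  assumes "u \<in> L2 \<Omega>" "u' \<in> L2 \<Omega>" "ud \<in> L2 \<Omega>" and "AE x in lebesgue_on \<Omega>. u x = u' x"
  shows "cost \<Omega> \<sigma> \<nu> ud u z = cost \<Omega> \<sigma> \<nu> ud u' z"
proof -
  have "AE x in lebesgue_on \<Omega>. u x - ud x = u' x - ud x" using assms(4) by eventually_elim simp
  then have "L2_inner \<Omega> (\<lambda>x. u x - ud x) (\<lambda>x. u x - ud x) = L2_inner \<Omega> (\<lambda>x. u' x - ud x) (\<lambda>x. u' x - ud x)"
    using assms(1-3) by (intro L2_inner_cong_AE L2_diff)
  then show ?thesis by (simp add: cost_def L2_norm_power2)
qed

text \<open>The state equation fixes the state up to a null set, which the cost does not see. The
  pair may therefore be compared through the representatives picked by \<open>S\<close>.\<close>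

lemma optimal_pair_iff:
  assumes onb: "L2_orthonormal_basis \<Omega> \<phi>" and \<mu>: "0 < \<mu>" "\<And>k. \<mu> \<le> lam k" and s: "0 < s"
    and ud: "ud \<in> L2 \<Omega>" and u: "u \<in> Hs \<Omega> lam \<phi> s" and z: "z \<in> Zad \<Omega> a b"
  defines "S \<equiv> control_to_state \<Omega> lam \<phi> s"
  shows "optimal_pair \<Omega> lam \<phi> s \<sigma> \<nu> ud a b u z \<longleftrightarrow> (AE x in lebesgue_on \<Omega>. u x = S z x) \<and>
    (\<forall>y \<in> Zad \<Omega> a b. cost \<Omega> \<sigma> \<nu> ud (S z) z \<le> cost \<Omega> \<sigma> \<nu> ud (S y) y)"
proof -
  have SHs: "S y \<in> Hs \<Omega> lam \<phi> s" if "y \<in> Zad \<Omega> a b" for y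
    unfolding S_def using that by (intro control_to_state(1)[OF onb _ \<mu> s]) (simp add: Zad_def)
  have Hs_L2: "v \<in> L2 \<Omega>" if "v \<in> Hs \<Omega> lam \<phi> s" for v using that by (simp add: Hs_def)
  have cost_eq: "cost \<Omega> \<sigma> \<nu> ud v y = cost \<Omega> \<sigma> \<nu> ud (S y) y"
    if "v \<in> Hs \<Omega> lam \<phi> s" "y \<in> Zad \<Omega> a b" "AE x in lebesgue_on \<Omega>. v x = S y x" for v y
    by (rule cost_cong_AE[OF Hs_L2[OF that(1)] Hs_L2[OF SHs[OF that(2)]] ud that(3)])
  show ?thesis
  proof
    assume opt: "optimal_pair \<Omega> lam \<phi> s \<sigma> \<nu> ud a b u z"
    then have eq: "AE x in lebesgue_on \<Omega>. u x = S z x" by (simp add: optimal_pair_def S_def)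
    moreover have "cost \<Omega> \<sigma> \<nu> ud (S z) z \<le> cost \<Omega> \<sigma> \<nu> ud (S y) y" if y: "y \<in> Zad \<Omega> a b" for y
    proof -
      have "AE x in lebesgue_on \<Omega>. S y x = S y x" by simp
      then have "cost \<Omega> \<sigma> \<nu> ud u z \<le> cost \<Omega> \<sigma> \<nu> ud (S y) y"
        using opt y SHs[OF y] unfolding optimal_pair_def S_def by blast
      then show ?thesis by (simp only: cost_eq[OF u z eq])
    qed
    ultimately show "(AE x in lebesgue_on \<Omega>. u x = S z x) \<and>
        (\<forall>y \<in> Zad \<Omega> a b. cost \<Omega> \<sigma> \<nu> ud (S z) z \<le> cost \<Omega> \<sigma> \<nu> ud (S y) y)" by blast
  next
    assume R: "(AE x in lebesgue_on \<Omega>. u x = S z x) \<and>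
        (\<forall>y \<in> Zad \<Omega> a b. cost \<Omega> \<sigma> \<nu> ud (S z) z \<le> cost \<Omega> \<sigma> \<nu> ud (S y) y)"
    have "cost \<Omega> \<sigma> \<nu> ud u z \<le> cost \<Omega> \<sigma> \<nu> ud v y"
      if "v \<in> Hs \<Omega> lam \<phi> s" "y \<in> Zad \<Omega> a b" "AE x in lebesgue_on \<Omega>. v x = S y x" for v y
      using R that(2) unfolding cost_eq[OF that] cost_eq[OF u z conjunct1[OF R]] by blast
    then show "optimal_pair \<Omega> lam \<phi> s \<sigma> \<nu> ud a b u z"
      using u z R unfolding optimal_pair_def S_def by blast
  qed
qed

text \<open>The state is affine in \<open>t\<close> almost everywhere, so the quadratic part is an
  exact polynomial, and the adjoint turns its first-order term into an inner product with
  \<open>h\<close>. The nonsmooth term stays an unexpanded difference. Small \<open>t\<close> serves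
  necessity, \<open>t = 1\<close> sufficiency.\<close>

lemma cost_expansion:
  assumes onb: "L2_orthonormal_basis \<Omega> \<phi>" and \<mu>: "0 < \<mu>" "\<And>k. \<mu> \<le> lam k" and s: "0 < s"
    and ud: "ud \<in> L2 \<Omega>" and z: "z \<in> L2 \<Omega>" and h: "h \<in> L2 \<Omega>"
  defines "S \<equiv> control_to_state \<Omega> lam \<phi> s"
  defines "p \<equiv> L2_adjoint \<Omega> S (\<lambda>x. S z x - ud x)"
  shows "cost \<Omega> \<sigma> \<nu> ud (S (\<lambda>x. z x + t * h x)) (\<lambda>x. z x + t * h x) =
    cost \<Omega> \<sigma> \<nu> ud (S z) z + t * L2_inner \<Omega> (\<lambda>x. p x + \<sigma> * z x) h
    + t\<^sup>2 / 2 * (L2_inner \<Omega> (S h) (S h) + \<sigma> * L2_inner \<Omega> h h)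
    + \<nu> * (L1_norm \<Omega> (\<lambda>x. z x + t * h x) - L1_norm \<Omega> z)"
proof -
  let ?z = "\<lambda>x. z x + t * h x"
  have S: "S y \<in> L2 \<Omega>" "L2_inner \<Omega> (S y) (\<phi> k) = lam k powr - s * L2_inner \<Omega> y (\<phi> k)"
    if "y \<in> L2 \<Omega>" for y k
    using control_to_state[OF onb that \<mu> s] by (auto simp: S_def Hs_def)
  have th: "(\<lambda>x. t * h x) \<in> L2 \<Omega>" and zth: "?z \<in> L2 \<Omega>" by (intro L2_add L2_scale z h)+
  let ?w = "\<lambda>x. S z x - ud x"
  have w: "?w \<in> L2 \<Omega>" by (intro L2_diff S(1) z ud)
  have p: "p \<in> L2 \<Omega>" "L2_inner \<Omega> p h = L2_inner \<Omega> ?w (S h)"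
    unfolding p_def S_def
    using control_to_state_adjoint[OF onb _ \<mu> s, of ?w] w h by (simp_all add: S_def)
  \<comment> \<open>Linearity cannot be read off the choice operator; it follows from the linear
    formula for the coefficients.\<close>
  have "AE x in lebesgue_on \<Omega>. S ?z x = S z x + t * S h x"
  proof (rule orthonormal_basis_eqI[OF onb S(1)[OF zth] L2_add[OF S(1)[OF z] L2_scale[OF S(1)[OF h]]]])
    fix k
    note k = orthonormal_basis_L2[OF onb, of k]
    show "L2_inner \<Omega> (S ?z) (\<phi> k) = L2_inner \<Omega> (\<lambda>x. S z x + t * S h x) (\<phi> k)"
      unfolding S(2)[OF zth] L2_inner_add_left[OF z th k] L2_inner_scale_left
        L2_inner_add_left[OF S(1)[OF z] L2_scale[OF S(1)[OF h]] k] S(2)[OF z] S(2)[OF h]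
      by (simp add: algebra_simps)
  qed
  then have cost_eq: "cost \<Omega> \<sigma> \<nu> ud (S ?z) ?z = cost \<Omega> \<sigma> \<nu> ud (\<lambda>x. S z x + t * S h x) ?z"
    by (intro cost_cong_AE S(1) zth L2_add L2_scale z h ud)
  have split: "(\<lambda>x. S z x + t * S h x - ud x) = (\<lambda>x. ?w x + t * S h x)" by (simp add: fun_eq_iff)
  have first_variation:
    "L2_inner \<Omega> (\<lambda>x. p x + \<sigma> * z x) h = L2_inner \<Omega> ?w (S h) + \<sigma> * L2_inner \<Omega> z h"
    unfolding L2_inner_add_left[OF p(1) L2_scale[OF z] h] L2_inner_scale_left p(2) ..
  have "1/2 * (w0 + 2 * t * w1 + t\<^sup>2 * w2) + \<sigma>/2 * (z0 + 2 * t * z1 + t\<^sup>2 * z2) + \<nu> * l1 =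
      1/2 * w0 + \<sigma>/2 * z0 + \<nu> * l0 + t * (w1 + \<sigma> * z1) + t\<^sup>2 / 2 * (w2 + \<sigma> * z2) + \<nu> * (l1 - l0)"
    for w0 w1 w2 z0 z1 z2 l0 l1 :: real by (simp add: field_simps)
  then show ?thesis
    unfolding cost_eq unfolding cost_def L2_norm_power2 first_variation split
      L2_inner_self_add_scale[OF w S(1)[OF h]] L2_inner_self_add_scale[OF z h] .
qed

theorem theorem3p6:
  fixes \<Omega> :: "(real^'n) set"
    and A :: "real^'n \<Rightarrow> real^'n^'n"
    and c :: "real^'n \<Rightarrow> real"
    and lam :: "nat \<Rightarrow> real"
    and \<phi> :: "nat \<Rightarrow> real^'n \<Rightarrow> real"
    and s \<sigma> \<nu> a b :: real
    and ud ubar zbar pbar :: "real^'n \<Rightarrow> real"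
    and S :: "(real^'n \<Rightarrow> real) \<Rightarrow> real^'n \<Rightarrow> real"
  assumes "\<Omega> \<noteq> {}" and "bounded \<Omega>" and "open \<Omega>" and "convex \<Omega>" and "polytope (closure \<Omega>)"
    and "0 < s" and "s < 1"
    and "elliptic_coefficients \<Omega> A c"
    and "\<And>k. 0 < lam k"
    and "\<And>k. eigenpair \<Omega> A c (lam k) (\<phi> k)"
    and "L2_orthonormal_basis \<Omega> \<phi>"
    and "0 < \<sigma>" and "0 < \<nu>"
    and "ud \<in> L2 \<Omega>"
    and "a < 0" and "0 < b"
    and "ubar \<in> Hs \<Omega> lam \<phi> s" and "zbar \<in> Zad \<Omega> a b"
    and "S = control_to_state \<Omega> lam \<phi> s"
    and "pbar = L2_adjoint \<Omega> S (\<lambda>x. S zbar x - ud x)"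
  shows "optimal_pair \<Omega> lam \<phi> s \<sigma> \<nu> ud a b ubar zbar \<longleftrightarrow>
    (AE x in lebesgue_on \<Omega>. ubar x = S zbar x) \<and>
    (\<exists>lbar \<in> L1_subdifferential \<Omega> (L1_norm \<Omega>) zbar.
       \<forall>z \<in> Zad \<Omega> a b.
         0 \<le> L2_inner \<Omega> (\<lambda>x. pbar x + \<sigma> * zbar x + \<nu> * lbar x) (\<lambda>x. z x - zbar x))"
proof -
  note onb = \<open>L2_orthonormal_basis \<Omega> \<phi>\<close> and ud = \<open>ud \<in> L2 \<Omega>\<close> and zbar = \<open>zbar \<in> Zad \<Omega> a b\<close>
  note S = \<open>S = control_to_state \<Omega> lam \<phi> s\<close>
    and pbar = \<open>pbar = L2_adjoint \<Omega> S (\<lambda>x. S zbar x - ud x)\<close>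
  have lm: "\<Omega> \<in> lmeasurable" using \<open>bounded \<Omega>\<close> \<open>open \<Omega>\<close> by (rule lmeasurable_open)
  obtain \<mu> where \<mu>0: "0 < \<mu>"
    and le: "\<And>l w. eigenpair \<Omega> A c l w \<Longrightarrow> 0 < l \<Longrightarrow> L2_inner \<Omega> w w = 1 \<Longrightarrow> \<mu> \<le> l"
    using eigenvalues_bounded_below[OF \<open>bounded \<Omega>\<close> \<open>open \<Omega>\<close> \<open>elliptic_coefficients \<Omega> A c\<close>] by blast
  have "\<mu> \<le> lam k" for k
    by (rule le[OF assms(10,9)]) (simp add: orthonormal_basis_inner[OF onb])
  note spec = \<mu>0 this \<open>0 < s\<close>
  have Zad_L2: "z \<in> L2 \<Omega>" if "z \<in> Zad \<Omega> a b" for z using that by (simp add: Zad_def)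
  have zbarL2: "zbar \<in> L2 \<Omega>" by (rule Zad_L2[OF zbar])
  define q where "q x = pbar x + \<sigma> * zbar x" for x
  have "(\<lambda>x. S zbar x - ud x) \<in> L2 \<Omega>"
    using control_to_state(1)[OF onb zbarL2 spec] ud by (auto simp: S Hs_def intro: L2_diff)
  then have "pbar \<in> L2 \<Omega>"
    unfolding pbar S by (intro control_to_state_adjoint(1)[OF onb _ spec]) (simp add: S)
  then have q: "q \<in> L2 \<Omega>" unfolding q_def by (intro L2_add L2_scale zbarL2)
  \<comment> \<open>Twice the coefficient of \<open>t\<^sup>2\<close> in the expansion. Necessity
    makes it negligible by a small step, sufficiency discards it by its sign.\<close>
  define K where "K z = L2_inner \<Omega> (S (\<lambda>x. z x - zbar x)) (S (\<lambda>x. z x - zbar x))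
    + \<sigma> * L2_inner \<Omega> (\<lambda>x. z x - zbar x) (\<lambda>x. z x - zbar x)" for z
  have K0: "0 \<le> K z" for z using \<open>0 < \<sigma>\<close> by (simp add: K_def L2_inner_self_nonneg)
  have expand: "cost \<Omega> \<sigma> \<nu> ud (S (\<lambda>x. zbar x + t * (z x - zbar x))) (\<lambda>x. zbar x + t * (z x - zbar x)) =
      cost \<Omega> \<sigma> \<nu> ud (S zbar) zbar + t * L2_inner \<Omega> q (\<lambda>x. z x - zbar x) + t\<^sup>2 / 2 * K z
      + \<nu> * (L1_norm \<Omega> (\<lambda>x. zbar x + t * (z x - zbar x)) - L1_norm \<Omega> zbar)"
    if "z \<in> Zad \<Omega> a b" for z t
    using cost_expansion[OF onb spec ud zbarL2 L2_diff[OF Zad_L2[OF that] zbarL2], where \<sigma>=\<sigma> and \<nu>=\<nu> and t=t]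
    unfolding K_def q_def pbar S by simp
  have "(\<forall>z \<in> Zad \<Omega> a b. cost \<Omega> \<sigma> \<nu> ud (S zbar) zbar \<le> cost \<Omega> \<sigma> \<nu> ud (S z) z) \<longleftrightarrow>
    (\<exists>lbar \<in> L1_subdifferential \<Omega> (L1_norm \<Omega>) zbar.
       \<forall>z \<in> Zad \<Omega> a b. 0 \<le> L2_inner \<Omega> (\<lambda>x. q x + \<nu> * lbar x) (\<lambda>x. z x - zbar x))"
    (is "?min \<longleftrightarrow> ?VI")
  proof
    assume ?min
    have "0 \<le> L2_inner \<Omega> q (\<lambda>x. z x - zbar x) + \<nu> * (L1_norm \<Omega> z - L1_norm \<Omega> zbar)" (is "0 \<le> ?X")
      if z: "z \<in> Zad \<Omega> a b" for z
    proof (rule field_le_epsilon)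
      fix e :: real assume "0 < e"
      \<comment> \<open>The bound 1 keeps the point on the admissible segment, the quotient gives
        \<open>t * K z \<le> e\<close>, and the added 1 excludes a zero denominator.\<close>
      define t where "t = min 1 (e / (K z + 1))"
      have t: "0 < t" "t \<le> 1" using \<open>0 < e\<close> K0[of z] by (auto simp: t_def)
      have "t * K z \<le> e / (K z + 1) * K z" using K0 by (intro mult_right_mono) (simp_all add: t_def)
      also have "\<dots> \<le> e" using \<open>0 < e\<close> K0[of z] by (simp add: divide_simps)
      finally have tK: "t * K z \<le> e" .
      have "cost \<Omega> \<sigma> \<nu> ud (S zbar) zbar \<le>
          cost \<Omega> \<sigma> \<nu> ud (S (\<lambda>x. zbar x + t * (z x - zbar x))) (\<lambda>x. zbar x + t * (z x - zbar x))"
        using \<open>?min\<close> Zad_convex[OF zbar z less_imp_le[OF t(1)] t(2)] by blast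
      \<comment> \<open>With this bound every term of the cost increment carries a factor
        \<open>t\<close>, which can then be cancelled.\<close>
      moreover have "\<nu> * L1_norm \<Omega> (\<lambda>x. zbar x + t * (z x - zbar x)) \<le>
          \<nu> * (L1_norm \<Omega> zbar + t * (L1_norm \<Omega> z - L1_norm \<Omega> zbar))"
        using t \<open>0 < \<nu>\<close> zbarL2 Zad_L2[OF z] by (intro mult_left_mono L1_norm_convex L2_subset_L1[OF lm]) auto
      ultimately have "0 \<le> t * (?X + t * K z / 2)"
        unfolding expand[OF z] by (simp add: algebra_simps power2_eq_square)
      then have "0 \<le> ?X + t * K z / 2" using t(1) by (simp add: zero_le_mult_iff)
      then show "0 \<le> ?X + e" using tK \<open>0 < e\<close> by linarith
    qed
    then show ?VI
    proof (rule L1_multiplier[OF lm q zbar \<open>a < 0\<close> \<open>0 < b\<close> \<open>0 < \<nu>\<close>])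
      fix l assume l: "l \<in> L1_subdifferential \<Omega> (L1_norm \<Omega>) zbar"
        and VI: "\<And>z. z \<in> Zad \<Omega> a b \<Longrightarrow> 0 \<le> L2_inner \<Omega> (\<lambda>x. q x + \<nu> * l x) (\<lambda>x. z x - zbar x)"
      show ?VI by (intro bexI[OF _ l] ballI VI)
    qed
  next
    assume ?VI
    then obtain l where l: "l \<in> L1_subdifferential \<Omega> (L1_norm \<Omega>) zbar"
      and VI: "\<And>z. z \<in> Zad \<Omega> a b \<Longrightarrow> 0 \<le> L2_inner \<Omega> (\<lambda>x. q x + \<nu> * l x) (\<lambda>x. z x - zbar x)" by blast
    have lL2: "l \<in> L2 \<Omega>" using l by (intro Linf_subset_L2[OF lm]) (simp add: L1_subdifferential_def)
    show ?min
    proof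
      fix z assume z: "z \<in> Zad \<Omega> a b"
      have h: "(\<lambda>x. z x - zbar x) \<in> L2 \<Omega>" by (rule L2_diff[OF Zad_L2[OF z] zbarL2])
      have "L1_norm \<Omega> zbar + L2_inner \<Omega> l (\<lambda>x. z x - zbar x) \<le> L1_norm \<Omega> z"
        using l L2_subset_L1[OF lm Zad_L2[OF z]] by (simp add: L1_subdifferential_def L2_inner_def)
      then have "\<nu> * L2_inner \<Omega> l (\<lambda>x. z x - zbar x) \<le> \<nu> * (L1_norm \<Omega> z - L1_norm \<Omega> zbar)"
        using \<open>0 < \<nu>\<close> by (intro mult_left_mono) auto
      moreover have "0 \<le> L2_inner \<Omega> q (\<lambda>x. z x - zbar x) + \<nu> * L2_inner \<Omega> l (\<lambda>x. z x - zbar x)"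
        using VI[OF z] L2_inner_add_left[OF q L2_scale[OF lL2, of \<nu>] h] by (simp add: L2_inner_scale_left)
      \<comment> \<open>At \<open>t = 1\<close> the segment ends at \<open>z\<close>. The
        subgradient inequality bounds the nonsmooth increment from below, and the quadratic
        remainder is nonnegative.\<close>
      ultimately show "cost \<Omega> \<sigma> \<nu> ud (S zbar) zbar \<le> cost \<Omega> \<sigma> \<nu> ud (S z) z"
        using expand[OF z, of 1] K0[of z] by simp
    qed
  qed
  then show ?thesis
    using optimal_pair_iff[OF onb spec ud \<open>ubar \<in> Hs \<Omega> lam \<phi> s\<close> zbar, where \<sigma>=\<sigma> and \<nu>=\<nu>]
    unfolding S q_def by blast
qed

end
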